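(* Let $(T,\eta,\mu)$ be a monad on a category $\mathcal{C}$ and let $L$ be a localization on $\mathcal{C}$ with unit $l$. Let $U$ be the forgetful functor from the category $\mathcal{C}^T$ of $T$-algebras to $\mathcal{C}$. Then the following statements are equivalent: (a) $T$ preserves $L$-equivalences. (b) For every $T$-algebra $(X,a)$ there is a $T$-algebra structure $\tilde a\colon TLX\to LX$ on $LX$ such that $l_X\colon (X,a)\to (LX,\tilde a)$ is a morphism of $T$-algebras, and if $g\colon (X,a)\to (Y,b)$ is any morphism of $T$-algebras then so is $Lg\colon (LX,\tilde a)\to (LY,\tilde b)$. (c) There is a localization $L^T$ on $\mathcal{C}^T$ with unit $l^T$ such that $LU=UL^T$ and $lU=Ul^T$. (d) There is a localization $L^T$ on $\mathcal{C}^T$ together with a natural isomorphism $LU\cong UL^T$. If these statements hold, then the $T$-algebra structures $\tilde a\colon TLX\to LX$ given in part (b) are unique and the localization $L^T$ in (c) is also unique. Moreover, $U$ preserves and reflects local objects and equivalences.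
   Context: A localization on a category $\mathcal{C}$ is a functor $L=JK\colon\mathcal{C}\to\mathcal{C}$ where $J\colon\mathcal{S}\hookrightarrow\mathcal{C}$ is the inclusion of a full reflective subcategory and $K$ is left adjoint to $J$; its unit $l\colon\mathrm{Id}\to L$ is the unit of this adjunction, and $(L,l)$ is an idempotent monad. An object $X$ is $L$-local if $l_X$ is an isomorphism. A morphism $g$ is an $L$-equivalence if $Lg$ is an isomorphism. For a monad $(T,\eta,\mu)$ on $\mathcal{C}$, the category $\mathcal{C}^T$ is the Eilenberg--Moore category, whose objects are $T$-algebras $(X,a)$ with $a\colon TX\to X$, and $U(X,a)=X$. Given localizations $L_1$ on $\mathcal{C}_1$ and $L_2$ on $\mathcal{C}_2$, a functor $F\colon\mathcal{C}_1\to\mathcal{C}_2$ preserves (resp. reflects) local objects if $FX$ is $L_2$-local whenever $X$ is $L_1$-local (resp. $X$ is $L_1$-local whenever $FX$ is $L_2$-local), and it preserves (resp. reflects) equivalences if $Ff$ is an $L_2$-equivalence whenever $f$ is an $L_1$-equivalence (resp. $f$ is an $L_1$-equivalence whenever $Ff$ is an $L_2$-equivalence). For $U$ these notions refer to $L^T$ on $\mathcal{C}^T$ and $L$ on $\mathcal{C}$. *)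

theory Defs
  imports Main
begin

record ('o, 'm) cat =
  Ob :: "'o set"
  Ar :: "'m set"
  Dom :: "'m \<Rightarrow> 'o"
  Cod :: "'m \<Rightarrow> 'o"
  Id :: "'o \<Rightarrow> 'm"
  Comp :: "'m \<Rightarrow> 'm \<Rightarrow> 'm" (infixr "\<cdot>\<index>" 70)

definition Hom :: "('o, 'm) cat \<Rightarrow> 'o \<Rightarrow> 'o \<Rightarrow> 'm set" where
  "Hom C X Y = {f \<in> Ar C. Dom C f = X \<and> Cod C f = Y}"

locale category =
  fixes C :: "('o, 'm) cat" (structure)
  assumes Dom_in_Ob: "f \<in> Ar C \<Longrightarrow> Dom C f \<in> Ob C"
    and Cod_in_Ob: "f \<in> Ar C \<Longrightarrow> Cod C f \<in> Ob C"
    and Id_in_Hom: "X \<in> Ob C \<Longrightarrow> Id C X \<in> Hom C X X"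
    and Comp_in_Hom: "\<lbrakk>f \<in> Hom C X Y; g \<in> Hom C Y Z\<rbrakk> \<Longrightarrow> g \<cdot> f \<in> Hom C X Z"
    and Comp_Id: "f \<in> Hom C X Y \<Longrightarrow> f \<cdot> Id C X = f"
    and Id_Comp: "f \<in> Hom C X Y \<Longrightarrow> Id C Y \<cdot> f = f"
    and Comp_assoc: "\<lbrakk>f \<in> Hom C W X; g \<in> Hom C X Y; h \<in> Hom C Y Z\<rbrakk>
      \<Longrightarrow> (h \<cdot> g) \<cdot> f = h \<cdot> (g \<cdot> f)"

definition is_iso :: "('o, 'm) cat \<Rightarrow> 'm \<Rightarrow> bool" where
  "is_iso C f \<longleftrightarrow> f \<in> Ar C \<and>
    (\<exists>g \<in> Hom C (Cod C f) (Dom C f).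
      g \<cdot>\<^bsub>C\<^esub> f = Id C (Dom C f) \<and> f \<cdot>\<^bsub>C\<^esub> g = Id C (Cod C f))"

text \<open>A functor is a pair of total functions whose values matter only on the objects and arrows
  of the source category; accordingly, equality of functors is agreement on that carrier.\<close>

record ('o1, 'm1, 'o2, 'm2) fctr =
  omap :: "'o1 \<Rightarrow> 'o2"
  amap :: "'m1 \<Rightarrow> 'm2"

locale is_functor = C: category C + D: category D
  for C :: "('o1, 'm1) cat" and D :: "('o2, 'm2) cat" +
  fixes F :: "('o1, 'm1, 'o2, 'm2) fctr"
  assumes omap_in_Ob: "X \<in> Ob C \<Longrightarrow> omap F X \<in> Ob D"
    and amap_in_Hom: "f \<in> Hom C X Y \<Longrightarrow> amap F f \<in> Hom D (omap F X) (omap F Y)"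
    and amap_Id: "X \<in> Ob C \<Longrightarrow> amap F (Id C X) = Id D (omap F X)"
    and amap_Comp: "\<lbrakk>f \<in> Hom C X Y; g \<in> Hom C Y Z\<rbrakk>
      \<Longrightarrow> amap F (g \<cdot>\<^bsub>C\<^esub> f) = amap F g \<cdot>\<^bsub>D\<^esub> amap F f"

definition functor_eq ::
    "('o1, 'm1) cat \<Rightarrow> ('o1, 'm1, 'o2, 'm2) fctr \<Rightarrow> ('o1, 'm1, 'o2, 'm2) fctr \<Rightarrow> bool" where
  "functor_eq C F G \<longleftrightarrow>
    (\<forall>X \<in> Ob C. omap F X = omap G X) \<and> (\<forall>f \<in> Ar C. amap F f = amap G f)"

definition id_functor :: "('o, 'm, 'o, 'm) fctr" where
  "id_functor = \<lparr>omap = (\<lambda>X. X), amap = (\<lambda>f. f)\<rparr>"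

definition comp_functor ::
    "('o2, 'm2, 'o3, 'm3) fctr \<Rightarrow> ('o1, 'm1, 'o2, 'm2) fctr \<Rightarrow> ('o1, 'm1, 'o3, 'm3) fctr"
    (infixr "\<circ>\<^sub>F" 70) where
  "G \<circ>\<^sub>F F = \<lparr>omap = omap G \<circ> omap F, amap = amap G \<circ> amap F\<rparr>"

definition nat_trans ::
    "('o1, 'm1) cat \<Rightarrow> ('o2, 'm2) cat \<Rightarrow> ('o1, 'm1, 'o2, 'm2) fctr \<Rightarrow>
     ('o1, 'm1, 'o2, 'm2) fctr \<Rightarrow> ('o1 \<Rightarrow> 'm2) \<Rightarrow> bool" where
  "nat_trans C D F G \<alpha> \<longleftrightarrow>
    is_functor C D F \<and> is_functor C D G \<and>
    (\<forall>X \<in> Ob C. \<alpha> X \<in> Hom D (omap F X) (omap G X)) \<and>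
    (\<forall>X Y. \<forall>f \<in> Hom C X Y. \<alpha> Y \<cdot>\<^bsub>D\<^esub> amap F f = amap G f \<cdot>\<^bsub>D\<^esub> \<alpha> X)"

definition nat_iso ::
    "('o1, 'm1) cat \<Rightarrow> ('o2, 'm2) cat \<Rightarrow> ('o1, 'm1, 'o2, 'm2) fctr \<Rightarrow>
     ('o1, 'm1, 'o2, 'm2) fctr \<Rightarrow> ('o1 \<Rightarrow> 'm2) \<Rightarrow> bool" where
  "nat_iso C D F G \<alpha> \<longleftrightarrow> nat_trans C D F G \<alpha> \<and> (\<forall>X \<in> Ob C. is_iso D (\<alpha> X))"

text \<open>\<open>K\<close> is left adjoint to \<open>J\<close>, with unit \<open>\<eta>\<close> and counit \<open>\<epsilon>\<close>.\<close>

definition adjunction ::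
    "('o1, 'm1) cat \<Rightarrow> ('o2, 'm2) cat \<Rightarrow> ('o1, 'm1, 'o2, 'm2) fctr \<Rightarrow>
     ('o2, 'm2, 'o1, 'm1) fctr \<Rightarrow> ('o1 \<Rightarrow> 'm1) \<Rightarrow> ('o2 \<Rightarrow> 'm2) \<Rightarrow> bool" where
  "adjunction C D K J \<eta> \<epsilon> \<longleftrightarrow>
    is_functor C D K \<and> is_functor D C J \<and>
    nat_trans C C id_functor (J \<circ>\<^sub>F K) \<eta> \<and> nat_trans D D (K \<circ>\<^sub>F J) id_functor \<epsilon> \<and>
    (\<forall>X \<in> Ob C. \<epsilon> (omap K X) \<cdot>\<^bsub>D\<^esub> amap K (\<eta> X) = Id D (omap K X)) \<and>
    (\<forall>Y \<in> Ob D. amap J (\<epsilon> Y) \<cdot>\<^bsub>C\<^esub> \<eta> (omap J Y) = Id C (omap J Y))"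

definition full_subcategory :: "('o, 'm) cat \<Rightarrow> 'o set \<Rightarrow> ('o, 'm) cat" where
  "full_subcategory C S =
    C \<lparr>Ob := S, Ar := {f \<in> Ar C. Dom C f \<in> S \<and> Cod C f \<in> S}\<rparr>"

text \<open>The inclusion functor of a subcategory has the same underlying data as the identity functor,
  since source and target are not part of the type of functors.\<close>

abbreviation inclusion_functor :: "('o, 'm, 'o, 'm) fctr" where
  "inclusion_functor \<equiv> id_functor"

definition localization ::
    "('o, 'm) cat \<Rightarrow> ('o, 'm, 'o, 'm) fctr \<Rightarrow> ('o \<Rightarrow> 'm) \<Rightarrow> bool" where
  "localization C L l \<longleftrightarrow>
    (\<exists>S K \<epsilon>. S \<subseteq> Ob C \<and>
      adjunction C (full_subcategory C S) K inclusion_functor l \<epsilon> \<and>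
      functor_eq C L (inclusion_functor \<circ>\<^sub>F K))"

definition local_object :: "('o, 'm) cat \<Rightarrow> ('o \<Rightarrow> 'm) \<Rightarrow> 'o \<Rightarrow> bool" where
  "local_object C l X \<longleftrightarrow> X \<in> Ob C \<and> is_iso C (l X)"

definition local_equivalence :: "('o, 'm) cat \<Rightarrow> ('o, 'm, 'o, 'm) fctr \<Rightarrow> 'm \<Rightarrow> bool" where
  "local_equivalence C L g \<longleftrightarrow> g \<in> Ar C \<and> is_iso C (amap L g)"

definition preserves_local_objects ::
    "('o1, 'm1) cat \<Rightarrow> ('o1 \<Rightarrow> 'm1) \<Rightarrow> ('o2, 'm2) cat \<Rightarrow> ('o2 \<Rightarrow> 'm2) \<Rightarrow>
     ('o1, 'm1, 'o2, 'm2) fctr \<Rightarrow> bool" where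
  "preserves_local_objects C1 l1 C2 l2 F \<longleftrightarrow>
    (\<forall>X \<in> Ob C1. local_object C1 l1 X \<longrightarrow> local_object C2 l2 (omap F X))"

definition reflects_local_objects ::
    "('o1, 'm1) cat \<Rightarrow> ('o1 \<Rightarrow> 'm1) \<Rightarrow> ('o2, 'm2) cat \<Rightarrow> ('o2 \<Rightarrow> 'm2) \<Rightarrow>
     ('o1, 'm1, 'o2, 'm2) fctr \<Rightarrow> bool" where
  "reflects_local_objects C1 l1 C2 l2 F \<longleftrightarrow>
    (\<forall>X \<in> Ob C1. local_object C2 l2 (omap F X) \<longrightarrow> local_object C1 l1 X)"

definition preserves_equivalences ::
    "('o1, 'm1) cat \<Rightarrow> ('o1, 'm1, 'o1, 'm1) fctr \<Rightarrow> ('o2, 'm2) cat \<Rightarrow> ('o2, 'm2, 'o2, 'm2) fctr \<Rightarrow>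
     ('o1, 'm1, 'o2, 'm2) fctr \<Rightarrow> bool" where
  "preserves_equivalences C1 L1 C2 L2 F \<longleftrightarrow>
    (\<forall>f \<in> Ar C1. local_equivalence C1 L1 f \<longrightarrow> local_equivalence C2 L2 (amap F f))"

definition reflects_equivalences ::
    "('o1, 'm1) cat \<Rightarrow> ('o1, 'm1, 'o1, 'm1) fctr \<Rightarrow> ('o2, 'm2) cat \<Rightarrow> ('o2, 'm2, 'o2, 'm2) fctr \<Rightarrow>
     ('o1, 'm1, 'o2, 'm2) fctr \<Rightarrow> bool" where
  "reflects_equivalences C1 L1 C2 L2 F \<longleftrightarrow>
    (\<forall>f \<in> Ar C1. local_equivalence C2 L2 (amap F f) \<longrightarrow> local_equivalence C1 L1 f)"

definition monad ::
    "('o, 'm) cat \<Rightarrow> ('o, 'm, 'o, 'm) fctr \<Rightarrow> ('o \<Rightarrow> 'm) \<Rightarrow> ('o \<Rightarrow> 'm) \<Rightarrow> bool" where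
  "monad C T \<eta> \<mu> \<longleftrightarrow>
    is_functor C C T \<and> nat_trans C C id_functor T \<eta> \<and> nat_trans C C (T \<circ>\<^sub>F T) T \<mu> \<and>
    (\<forall>X \<in> Ob C.
      \<mu> X \<cdot>\<^bsub>C\<^esub> amap T (\<mu> X) = \<mu> X \<cdot>\<^bsub>C\<^esub> \<mu> (omap T X) \<and>
      \<mu> X \<cdot>\<^bsub>C\<^esub> amap T (\<eta> X) = Id C (omap T X) \<and>
      \<mu> X \<cdot>\<^bsub>C\<^esub> \<eta> (omap T X) = Id C (omap T X))"

definition algebra ::
    "('o, 'm) cat \<Rightarrow> ('o, 'm, 'o, 'm) fctr \<Rightarrow> ('o \<Rightarrow> 'm) \<Rightarrow> ('o \<Rightarrow> 'm) \<Rightarrow> 'o \<times> 'm \<Rightarrow> bool" where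
  "algebra C T \<eta> \<mu> = (\<lambda>(X, a).
    X \<in> Ob C \<and> a \<in> Hom C (omap T X) X \<and>
    a \<cdot>\<^bsub>C\<^esub> \<eta> X = Id C X \<and> a \<cdot>\<^bsub>C\<^esub> amap T a = a \<cdot>\<^bsub>C\<^esub> \<mu> X)"

definition algebra_morphism ::
    "('o, 'm) cat \<Rightarrow> ('o, 'm, 'o, 'm) fctr \<Rightarrow> ('o \<Rightarrow> 'm) \<Rightarrow> ('o \<Rightarrow> 'm) \<Rightarrow>
     'o \<times> 'm \<Rightarrow> 'o \<times> 'm \<Rightarrow> 'm \<Rightarrow> bool" where
  "algebra_morphism C T \<eta> \<mu> = (\<lambda>(X, a) (Y, b) g.
    algebra C T \<eta> \<mu> (X, a) \<and> algebra C T \<eta> \<mu> (Y, b) \<and>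
    g \<in> Hom C X Y \<and> b \<cdot>\<^bsub>C\<^esub> amap T g = g \<cdot>\<^bsub>C\<^esub> a)"

text \<open>An arrow of the Eilenberg--Moore category is a triple \<open>(A, g, B)\<close>: the underlying arrow
  \<open>g\<close> of \<open>C\<close> does not determine the algebra structures on its source and target.\<close>

definition em_category ::
    "('o, 'm) cat \<Rightarrow> ('o, 'm, 'o, 'm) fctr \<Rightarrow> ('o \<Rightarrow> 'm) \<Rightarrow> ('o \<Rightarrow> 'm) \<Rightarrow>
     ('o \<times> 'm, ('o \<times> 'm) \<times> 'm \<times> ('o \<times> 'm)) cat" where
  "em_category C T \<eta> \<mu> =
    \<lparr>Ob = {A. algebra C T \<eta> \<mu> A},
     Ar = {(A, g, B). algebra_morphism C T \<eta> \<mu> A B g},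
     Dom = (\<lambda>(A, g, B). A),
     Cod = (\<lambda>(A, g, B). B),
     Id = (\<lambda>A. (A, Id C (fst A), A)),
     Comp = (\<lambda>(_, h, D) (A, g, _). (A, h \<cdot>\<^bsub>C\<^esub> g, D))\<rparr>"

definition em_forget :: "('o \<times> 'm, ('o \<times> 'm) \<times> 'm \<times> ('o \<times> 'm), 'o, 'm) fctr" where
  "em_forget = \<lparr>omap = (\<lambda>(X, a). X), amap = (\<lambda>(A, g, B). g)\<rparr>"

text \<open>A choice of structure \<open>t (X, a)\<close> on \<open>L X\<close>, for every algebra \<open>(X, a)\<close>, for which the components
  of the unit \<open>l\<close> and the images under \<open>L\<close> of algebra morphisms are algebra morphisms.\<close>

definition lifts_to_algebras ::
    "('o, 'm) cat \<Rightarrow> ('o, 'm, 'o, 'm) fctr \<Rightarrow> ('o \<Rightarrow> 'm) \<Rightarrow> ('o \<Rightarrow> 'm) \<Rightarrow>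
     ('o, 'm, 'o, 'm) fctr \<Rightarrow> ('o \<Rightarrow> 'm) \<Rightarrow> ('o \<times> 'm \<Rightarrow> 'm) \<Rightarrow> bool" where
  "lifts_to_algebras C T \<eta> \<mu> L l t \<longleftrightarrow>
    (\<forall>X a. algebra C T \<eta> \<mu> (X, a) \<longrightarrow>
      algebra C T \<eta> \<mu> (omap L X, t (X, a)) \<and>
      algebra_morphism C T \<eta> \<mu> (X, a) (omap L X, t (X, a)) (l X)) \<and>
    (\<forall>X a Y b g. algebra_morphism C T \<eta> \<mu> (X, a) (Y, b) g \<longrightarrow>
      algebra_morphism C T \<eta> \<mu> (omap L X, t (X, a)) (omap L Y, t (Y, b)) (amap L g))"

text \<open>\<open>L U = U L'\<close> and \<open>l U = U l'\<close>, for \<open>U\<close> a functor with source \<open>D\<close>.\<close>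

definition lifts_strictly ::
    "('o1, 'm1) cat \<Rightarrow> ('o1, 'm1, 'o2, 'm2) fctr \<Rightarrow> ('o2, 'm2, 'o2, 'm2) fctr \<Rightarrow> ('o2 \<Rightarrow> 'm2) \<Rightarrow>
     ('o1, 'm1, 'o1, 'm1) fctr \<Rightarrow> ('o1 \<Rightarrow> 'm1) \<Rightarrow> bool" where
  "lifts_strictly D U L l L' l' \<longleftrightarrow>
    functor_eq D (L \<circ>\<^sub>F U) (U \<circ>\<^sub>F L') \<and> (\<forall>A \<in> Ob D. l (omap U A) = amap U (l' A))"

end

theory Submission
  imports Defs
begin

text \<open>A localization is the same as an idempotent monad \<open>(L, l)\<close>, and an arrow \<open>f\<close> is an
  \<open>L\<close>-equivalence iff every local object is orthogonal to \<open>f\<close>. If \<open>T\<close> preserves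
  \<open>L\<close>-equivalences, then \<open>T l\<^sub>X\<close> and \<open>T T l\<^sub>X\<close> are \<open>L\<close>-equivalences, so that \<open>l\<^sub>X a\<close> extends
  uniquely along \<open>T l\<^sub>X\<close> to a map \<open>T L X \<rightarrow> L X\<close>; the algebra axioms for this map hold because they
  hold after composition with an \<open>L\<close>-equivalence. Conversely, an isomorphism \<open>L U \<cong> U L\<^sup>T\<close> of any
  kind, even one that ignores the units, forces \<open>U\<close> to preserve local objects: if \<open>A\<close> is
  \<open>L\<^sup>T\<close>-local, then \<open>U A \<cong> U L\<^sup>T A \<cong> L U A\<close>. By adjointness the free algebra functor preserves
  equivalences, and hence so does \<open>T\<close>.\<close>

section \<open>Isomorphisms in a category\<close>

context category
begin

lemma HomD: "f \<in> Hom C X Y \<Longrightarrow> f \<in> Ar C \<and> X \<in> Ob C \<and> Y \<in> Ob C \<and> Dom C f = X \<and> Cod C f = Y"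
  using Dom_in_Ob Cod_in_Ob by (auto simp: Hom_def)

lemma Ar_Hom: "f \<in> Ar C \<Longrightarrow> f \<in> Hom C (Dom C f) (Cod C f)"
  by (simp add: Hom_def)

lemma is_isoI:
  assumes "f \<in> Hom C X Y" "g \<in> Hom C Y X" "g \<cdot> f = Id C X" "f \<cdot> g = Id C Y"
  shows "is_iso C f"
  using assms HomD[OF assms(1)] by (auto simp: is_iso_def)

lemma is_isoE:
  assumes "is_iso C f" "f \<in> Hom C X Y"
  obtains g where "g \<in> Hom C Y X" "g \<cdot> f = Id C X" "f \<cdot> g = Id C Y" "is_iso C g"
proof -
  obtain g where g: "g \<in> Hom C Y X" "g \<cdot> f = Id C X" "f \<cdot> g = Id C Y"
    using assms HomD[OF assms(2)] by (auto simp: is_iso_def)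
  moreover have "is_iso C g" using g assms(2) by (blast intro: is_isoI)
  ultimately show thesis using that by blast
qed

lemma iso_Id: "X \<in> Ob C \<Longrightarrow> is_iso C (Id C X)"
  by (meson Comp_Id Id_in_Hom is_isoI)

lemma iso_cancel_right:
  assumes "is_iso C f" "f \<in> Hom C X Y" "g \<in> Hom C Y Z" "h \<in> Hom C Y Z" "g \<cdot> f = h \<cdot> f"
  shows "g = h"
proof -
  obtain f' where f': "f' \<in> Hom C Y X" "f \<cdot> f' = Id C Y"
    using assms(1,2) by (rule is_isoE)
  have "(g \<cdot> f) \<cdot> f' = (h \<cdot> f) \<cdot> f'" using assms(5) by simp
  then show ?thesis
    using Comp_assoc[OF f'(1) assms(2,3)] Comp_assoc[OF f'(1) assms(2,4)] f'(2)
      Comp_Id[OF assms(3)] Comp_Id[OF assms(4)] by simp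
qed

lemma iso_cancel_left:
  assumes "is_iso C f" "f \<in> Hom C Y Z" "g \<in> Hom C X Y" "h \<in> Hom C X Y" "f \<cdot> g = f \<cdot> h"
  shows "g = h"
proof -
  obtain f' where f': "f' \<in> Hom C Z Y" "f' \<cdot> f = Id C Y"
    using assms(1,2) by (rule is_isoE)
  have "f' \<cdot> (f \<cdot> g) = f' \<cdot> (f \<cdot> h)" using assms(5) by simp
  then show ?thesis
    using Comp_assoc[OF assms(3,2) f'(1)] Comp_assoc[OF assms(4,2) f'(1)] f'(2)
      Id_Comp[OF assms(3)] Id_Comp[OF assms(4)] by simp
qed

lemma iso_Comp:
  assumes f: "f \<in> Hom C X Y" "is_iso C f" and g: "g \<in> Hom C Y Z" "is_iso C g"
  shows "is_iso C (g \<cdot> f)"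
proof -
  obtain f' where f': "f' \<in> Hom C Y X" "f' \<cdot> f = Id C X" "f \<cdot> f' = Id C Y"
    using f(2,1) by (rule is_isoE)
  obtain g' where g': "g' \<in> Hom C Z Y" "g' \<cdot> g = Id C Y" "g \<cdot> g' = Id C Z"
    using g(2,1) by (rule is_isoE)
  have gf: "g \<cdot> f \<in> Hom C X Z" and fg: "f' \<cdot> g' \<in> Hom C Z X"
    using f(1) g(1) f'(1) g'(1) Comp_in_Hom by blast+
  have "(f' \<cdot> g') \<cdot> (g \<cdot> f) = f' \<cdot> ((g' \<cdot> g) \<cdot> f)"
    using Comp_assoc[OF gf g'(1) f'(1)] Comp_assoc[OF f(1) g(1) g'(1)] by simp
  also have "\<dots> = Id C X" using g'(2) f'(2) Id_Comp[OF f(1)] by simp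
  finally have 1: "(f' \<cdot> g') \<cdot> (g \<cdot> f) = Id C X" .
  have "(g \<cdot> f) \<cdot> (f' \<cdot> g') = g \<cdot> ((f \<cdot> f') \<cdot> g')"
    using Comp_assoc[OF fg f(1) g(1)] Comp_assoc[OF g'(1) f'(1) f(1)] by simp
  also have "\<dots> = Id C Z" using f'(3) g'(3) Id_Comp[OF g'(1)] by simp
  finally show ?thesis using is_isoI[OF gf fg 1] by blast
qed

lemma iso_square_imp:
  assumes a: "a \<in> Hom C X X'" "is_iso C a" and b: "b \<in> Hom C Y Y'" "is_iso C b"
    and f: "f \<in> Hom C X Y" "is_iso C f" and g: "g \<in> Hom C X' Y'" and sq: "b \<cdot> f = g \<cdot> a"
  shows "is_iso C g"
proof -
  obtain a' where a': "a' \<in> Hom C X' X" "a \<cdot> a' = Id C X'" "is_iso C a'"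
    using a(2,1) by (rule is_isoE)
  have "g = (b \<cdot> f) \<cdot> a'"
    using Comp_assoc[OF a'(1) a(1) g] a'(2) Comp_Id[OF g] sq by simp
  then show ?thesis
    using iso_Comp[OF a'(1,3) Comp_in_Hom[OF f(1) b(1)] iso_Comp[OF f b]] by simp
qed

text \<open>Isomorphy is compared later along squares given by naturality of \<open>l\<close> or of
  \<open>\<phi>\<close>. The converse direction is \<open>iso_square_imp\<close> for the square
  whose sides are the inverses of \<open>a\<close> and \<open>b\<close>.\<close>

lemma iso_square:
  assumes a: "a \<in> Hom C X X'" "is_iso C a" and b: "b \<in> Hom C Y Y'" "is_iso C b"
    and f: "f \<in> Hom C X Y" and g: "g \<in> Hom C X' Y'" and sq: "b \<cdot> f = g \<cdot> a"
  shows "is_iso C f \<longleftrightarrow> is_iso C g"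
proof
  show "is_iso C f \<Longrightarrow> is_iso C g" using iso_square_imp[OF a b f _ g sq] .
next
  assume gi: "is_iso C g"
  obtain a' where a': "a' \<in> Hom C X' X" "a' \<cdot> a = Id C X" "a \<cdot> a' = Id C X'" "is_iso C a'"
    using a(2,1) by (rule is_isoE)
  obtain b' where b': "b' \<in> Hom C Y' Y" "b' \<cdot> b = Id C Y" "is_iso C b'"
    using b(2,1) by (rule is_isoE)
  have "b' \<cdot> g = b' \<cdot> (g \<cdot> (a \<cdot> a'))" using a'(3) Comp_Id[OF g] by simp
  also have "\<dots> = b' \<cdot> ((b \<cdot> f) \<cdot> a')" using Comp_assoc[OF a'(1) a(1) g] sq by simp
  also have "\<dots> = b' \<cdot> (b \<cdot> (f \<cdot> a'))" using Comp_assoc[OF a'(1) f b(1)] by simp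
  also have "\<dots> = f \<cdot> a'"
    using Comp_assoc[OF Comp_in_Hom[OF a'(1) f] b(1) b'(1)] b'(2)
      Id_Comp[OF Comp_in_Hom[OF a'(1) f]] by simp
  finally show "is_iso C f"
    using iso_square_imp[OF a'(1,4) b'(1,3) g gi f] by blast
qed

end

context is_functor
begin

lemma amap_in_Ar: "f \<in> Ar C \<Longrightarrow> amap F f \<in> Ar D"
  using amap_in_Hom[OF C.Ar_Hom] D.HomD by blast

lemma amap_iso:
  assumes "f \<in> Hom C X Y" "is_iso C f"
  shows "is_iso D (amap F f)"
proof -
  obtain g where g: "g \<in> Hom C Y X" "g \<cdot>\<^bsub>C\<^esub> f = Id C X" "f \<cdot>\<^bsub>C\<^esub> g = Id C Y"
    using assms(2,1) by (rule C.is_isoE)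
  show ?thesis
  proof (rule D.is_isoI)
    show "amap F f \<in> Hom D (omap F X) (omap F Y)" "amap F g \<in> Hom D (omap F Y) (omap F X)"
      using assms(1) g(1) amap_in_Hom by blast+
    show "amap F g \<cdot>\<^bsub>D\<^esub> amap F f = Id D (omap F X)" "amap F f \<cdot>\<^bsub>D\<^esub> amap F g = Id D (omap F Y)"
      using amap_Comp[OF assms(1) g(1)] amap_Comp[OF g(1) assms(1)] g(2,3) amap_Id
        C.HomD[OF assms(1)] by auto
  qed
qed

end

section \<open>Identity functors, composites and equality on the carrier\<close>

lemma is_functor_id: "category C \<Longrightarrow> is_functor C C id_functor"
  by (simp add: is_functor_def is_functor_axioms_def id_functor_def)

lemma is_functor_comp:
  assumes "is_functor C D F" "is_functor D E G"
  shows "is_functor C E (G \<circ>\<^sub>F F)"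
proof -
  interpret F: is_functor C D F by fact
  interpret G: is_functor D E G by fact
  show ?thesis
    by unfold_locales
      (auto simp: comp_functor_def F.omap_in_Ob G.omap_in_Ob F.amap_Id G.amap_Id
        intro!: G.amap_in_Hom F.amap_in_Hom F.amap_Comp[THEN arg_cong, THEN trans] G.amap_Comp)
qed

lemma comp_functor_sel [simp]:
  "omap (G \<circ>\<^sub>F F) X = omap G (omap F X)"
  "amap (G \<circ>\<^sub>F F) f = amap G (amap F f)"
  by (simp_all add: comp_functor_def)

text \<open>The inclusion of a full subcategory has the data of \<open>id_functor\<close>, so these
  equations identify its composites with a reflector \<open>K\<close> with \<open>K\<close>
  itself.\<close>

lemma comp_functor_id [simp]: "F \<circ>\<^sub>F id_functor = F" "id_functor \<circ>\<^sub>F F = F"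
  by (cases F; simp add: comp_functor_def id_functor_def comp_def)+

text \<open>\<open>localization\<close> determines \<open>L\<close> only up to
  \<open>functor_eq\<close>; this moves functoriality from the reflector \<open>K\<close> to
  \<open>L\<close>.\<close>

lemma is_functor_cong:
  assumes "is_functor C D F" "functor_eq C G F"
  shows "is_functor C D G"
proof -
  interpret F: is_functor C D F by fact
  have o: "omap G X = omap F X" if "X \<in> Ob C" for X
    using assms(2) that by (simp add: functor_eq_def)
  have a: "amap G f = amap F f" if "f \<in> Hom C X Y" for f X Y
    using assms(2) F.C.HomD[OF that] by (simp add: functor_eq_def)
  show ?thesis
  proof unfold_locales
    fix X assume X: "X \<in> Ob C"
    show "omap G X \<in> Ob D" using X o F.omap_in_Ob by simp
    show "amap G (Id C X) = Id D (omap G X)"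
      using X o a[OF F.C.Id_in_Hom[OF X]] F.amap_Id by simp
  next
    fix f X Y assume f: "f \<in> Hom C X Y"
    show "amap G f \<in> Hom D (omap G X) (omap G Y)"
      using o a[OF f] F.amap_in_Hom[OF f] F.C.HomD[OF f] by simp
    fix g Z assume g: "g \<in> Hom C Y Z"
    show "amap G (g \<cdot>\<^bsub>C\<^esub> f) = amap G g \<cdot>\<^bsub>D\<^esub> amap G f"
      using a[OF f] a[OF g] a[OF F.C.Comp_in_Hom[OF f g]] F.amap_Comp[OF f g] by simp
  qed
qed

section \<open>Localizations as idempotent monads\<close>

text \<open>The multiplication is not part of the data: at \<open>X\<close> it is the inverse of
  \<open>l (omap L X)\<close>. Neither a subcategory nor an adjunction occurs, so this form is
  easier to lift to algebras.\<close>

locale idempotent_monad = is_functor C C L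
  for C :: "('o, 'm) cat" (structure) and L :: "('o, 'm, 'o, 'm) fctr" +
  fixes l :: "'o \<Rightarrow> 'm"
  assumes unit_in_Hom: "X \<in> Ob C \<Longrightarrow> l X \<in> Hom C X (omap L X)"
    and unit_natural: "f \<in> Hom C X Y \<Longrightarrow> l Y \<cdot> f = amap L f \<cdot> l X"
    and amap_unit: "X \<in> Ob C \<Longrightarrow> amap L (l X) = l (omap L X)"
    and iso_unit: "X \<in> Ob C \<Longrightarrow> is_iso C (l (omap L X))"

lemma category_full_subcategory:
  assumes "category C" "S \<subseteq> Ob C"
  shows "category (full_subcategory C S)"
proof -
  interpret category C by fact
  show ?thesis
  proof unfold_locales
    fix f X Y g Z
    assume f: "f \<in> Hom (full_subcategory C S) X Y" and g: "g \<in> Hom (full_subcategory C S) Y Z"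
    then have "f \<in> Hom C X Y" "g \<in> Hom C Y Z" "X \<in> S" "Z \<in> S"
      by (auto simp: Hom_def full_subcategory_def)
    then show "g \<cdot>\<^bsub>full_subcategory C S\<^esub> f \<in> Hom (full_subcategory C S) X Z"
      using Comp_in_Hom[of f X Y g Z] by (auto simp: Hom_def full_subcategory_def)
  next
    fix f W X Y Z g h
    assume "f \<in> Hom (full_subcategory C S) W X" "g \<in> Hom (full_subcategory C S) X Y"
      "h \<in> Hom (full_subcategory C S) Y Z"
    then have "f \<in> Hom C W X" "g \<in> Hom C X Y" "h \<in> Hom C Y Z"
      by (auto simp: Hom_def full_subcategory_def)
    from Comp_assoc[OF this]
    show "(h \<cdot>\<^bsub>full_subcategory C S\<^esub> g) \<cdot>\<^bsub>full_subcategory C S\<^esub> f =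
      h \<cdot>\<^bsub>full_subcategory C S\<^esub> (g \<cdot>\<^bsub>full_subcategory C S\<^esub> f)"
      by (simp add: full_subcategory_def)
  qed (use assms(2) Id_in_Hom Comp_Id Id_Comp in \<open>auto simp: Hom_def full_subcategory_def\<close>)
qed

lemma Hom_full_subcategory:
  "f \<in> Hom (full_subcategory C S) X Y \<longleftrightarrow> f \<in> Hom C X Y \<and> X \<in> S \<and> Y \<in> S"
  by (auto simp: Hom_def full_subcategory_def)

lemma full_subcategory_sel [simp]:
  "Ob (full_subcategory C S) = S"
  "Id (full_subcategory C S) = Id C"
  "Comp (full_subcategory C S) = Comp C"
  by (simp_all add: full_subcategory_def)

text \<open>On the subcategory the counit is a two-sided inverse of the unit, so the unit is
  invertible at every \<open>omap K X\<close>. Both \<open>amap K (l X)\<close> and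
  \<open>l (omap K X)\<close> are sections of the invertible \<open>\<epsilon> (omap K X)\<close>,
  hence equal.\<close>

lemma idempotent_monad_if_localization:
  assumes "localization C L l"
  shows "idempotent_monad C L l"
proof -
  obtain S K \<epsilon> where S: "S \<subseteq> Ob C"
    and adj: "adjunction C (full_subcategory C S) K inclusion_functor l \<epsilon>"
    and eq: "functor_eq C L (inclusion_functor \<circ>\<^sub>F K)"
    using assms by (auto simp: localization_def)
  have JK: "inclusion_functor \<circ>\<^sub>F K = K" and KJ: "K \<circ>\<^sub>F inclusion_functor = K"
    by simp_all
  interpret K: is_functor C "full_subcategory C S" K
    using adj by (simp add: adjunction_def)
  have nat_l: "nat_trans C C id_functor K l"
    and nat_e: "nat_trans (full_subcategory C S) (full_subcategory C S) K id_functor \<epsilon>"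
    and tri1: "X \<in> Ob C \<Longrightarrow> \<epsilon> (omap K X) \<cdot>\<^bsub>C\<^esub> amap K (l X) = Id C (omap K X)"
    and tri2: "Y \<in> S \<Longrightarrow> \<epsilon> Y \<cdot>\<^bsub>C\<^esub> l Y = Id C Y" for X Y
    using adj JK KJ by (simp_all add: adjunction_def) (simp_all add: id_functor_def)
  have eqL: "functor_eq C L K" using eq JK by simp
  have o: "omap L X = omap K X" if "X \<in> Ob C" for X
    using eqL that by (simp add: functor_eq_def)
  have a: "amap L f = amap K f" if "f \<in> Hom C X Y" for f X Y
    using eqL K.C.HomD[OF that] by (simp add: functor_eq_def)
  have KS: "omap K X \<in> S" if "X \<in> Ob C" for X using K.omap_in_Ob[OF that] by simp
  have l_Hom: "l X \<in> Hom C X (omap K X)" if "X \<in> Ob C" for X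
    using nat_l that by (simp add: nat_trans_def id_functor_def)
  have l_nat: "l Y \<cdot>\<^bsub>C\<^esub> f = amap K f \<cdot>\<^bsub>C\<^esub> l X" if "f \<in> Hom C X Y" for f X Y
    using nat_l that by (simp add: nat_trans_def id_functor_def)
  have e_Hom: "\<epsilon> Y \<in> Hom C (omap K Y) Y" if "Y \<in> S" for Y
    using nat_e that by (simp add: nat_trans_def id_functor_def Hom_full_subcategory)
  have e_nat: "\<epsilon> Y \<cdot>\<^bsub>C\<^esub> amap K f = f \<cdot>\<^bsub>C\<^esub> \<epsilon> X" if "f \<in> Hom C X Y" "X \<in> S" "Y \<in> S" for f X Y
    using nat_e that by (simp add: nat_trans_def id_functor_def Hom_full_subcategory)
  \<comment> \<open>Naturality of \<open>\<epsilon>\<close> at \<open>l Y\<close>, an arrow of the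
    subcategory by fullness, reduces this to the triangle identity \<open>tri1\<close>.\<close>
  have le: "l Y \<cdot>\<^bsub>C\<^esub> \<epsilon> Y = Id C (omap K Y)" if "Y \<in> S" for Y
    using e_nat[OF l_Hom that KS] tri1 S that by auto
  have iso_l: "is_iso C (l Y)" if "Y \<in> S" for Y
    using K.C.is_isoI[OF l_Hom e_Hom tri2 le] S that by blast
  have iso_e: "is_iso C (\<epsilon> Y)" if "Y \<in> S" for Y
    using K.C.is_isoI[OF e_Hom l_Hom le tri2] S that by blast
  have Kl: "amap K (l X) = l (omap K X)" if X: "X \<in> Ob C" for X
  proof -
    have KX: "omap K X \<in> Ob C" using KS[OF X] S by blast
    have "\<epsilon> (omap K X) \<cdot>\<^bsub>C\<^esub> amap K (l X) = \<epsilon> (omap K X) \<cdot>\<^bsub>C\<^esub> l (omap K X)"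
      using tri1[OF X] tri2[OF KS[OF X]] by simp
    moreover have "amap K (l X) \<in> Hom C (omap K X) (omap K (omap K X))"
      using K.amap_in_Hom[OF l_Hom[OF X]] by (simp add: Hom_full_subcategory)
    ultimately show ?thesis
      using K.C.iso_cancel_left[OF iso_e[OF KS[OF X]] e_Hom[OF KS[OF X]]] l_Hom[OF KX] by blast
  qed
  have "is_functor C C K" using nat_l by (simp add: nat_trans_def)
  then have "is_functor C C L" using eqL by (rule is_functor_cong)
  then interpret L: is_functor C C L .
  show ?thesis
  proof unfold_locales
    fix X assume X: "X \<in> Ob C"
    show "l X \<in> Hom C X (omap L X)" using l_Hom X o by simp
    show "amap L (l X) = l (omap L X)" using Kl X o a[OF l_Hom[OF X]] by simp
    show "is_iso C (l (omap L X))" using iso_l KS X o by simp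
  next
    fix f X Y assume "f \<in> Hom C X Y"
    then show "l Y \<cdot>\<^bsub>C\<^esub> f = amap L f \<cdot>\<^bsub>C\<^esub> l X" using l_nat a by simp
  qed
qed

context idempotent_monad
begin

lemma unit_nat_trans: "nat_trans C C id_functor L l"
  unfolding nat_trans_def
  using is_functor_id[OF C.category_axioms] is_functor_axioms unit_in_Hom unit_natural
  by (simp add: id_functor_def)

lemma local_omap: "X \<in> Ob C \<Longrightarrow> local_object C l (omap L X)"
  by (simp add: local_object_def omap_in_Ob iso_unit)

lemma unit_equivalence: "X \<in> Ob C \<Longrightarrow> is_iso C (amap L (l X))"
  by (simp add: amap_unit iso_unit)

text \<open>The reflective subcategory consists of all local objects, \<open>L\<close> itself serves
  as reflector, and the counit at a local object is the inverse of its unit. One triangle identity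
  then comes from \<open>amap_unit\<close>, the other from the choice of the inverse.\<close>

lemma is_localization: "localization C L l"
proof -
  define S where "S = {X \<in> Ob C. is_iso C (l X)}"
  define D where "D = full_subcategory C S"
  have S: "S \<subseteq> Ob C" by (auto simp: S_def)
  interpret D: category D
    unfolding D_def using category_full_subcategory[OF C.category_axioms S] .
  have HomDD: "f \<in> Hom D X Y \<longleftrightarrow> f \<in> Hom C X Y \<and> X \<in> S \<and> Y \<in> S" for f X Y
    by (simp add: D_def Hom_full_subcategory)
  have D_sel [simp]: "Ob D = S" "Id D = Id C" "Comp D = Comp C"
    by (simp_all add: D_def)
  have "\<exists>e. e \<in> Hom C (omap L X) X \<and> e \<cdot> l X = Id C X \<and> l X \<cdot> e = Id C (omap L X)"
    if "X \<in> S" for X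
    using that unit_in_Hom[of X] C.is_isoE[of "l X" X "omap L X"] by (auto simp: S_def)
  then obtain \<epsilon> where e: "\<And>X. X \<in> S \<Longrightarrow> \<epsilon> X \<in> Hom C (omap L X) X"
    and el: "\<And>X. X \<in> S \<Longrightarrow> \<epsilon> X \<cdot> l X = Id C X"
    and le: "\<And>X. X \<in> S \<Longrightarrow> l X \<cdot> \<epsilon> X = Id C (omap L X)"
    by metis
  have LS: "omap L X \<in> S" if "X \<in> Ob C" for X
    using that omap_in_Ob iso_unit by (simp add: S_def)
  have K: "is_functor C D L"
    by unfold_locales (auto simp: LS HomDD amap_in_Hom amap_Id amap_Comp dest: C.HomD)
  have J: "is_functor D C id_functor"
    by unfold_locales (auto simp: HomDD id_functor_def S_def)
  have KJ: "L \<circ>\<^sub>F id_functor = L" and JK: "id_functor \<circ>\<^sub>F L = L"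
    by simp_all
  \<comment> \<open>Both sides agree after composition with \<open>l X\<close>, which is invertible
    because \<open>X\<close> is local.\<close>
  have e_nat: "\<epsilon> Y \<cdot> amap L f = f \<cdot> \<epsilon> X" if f: "f \<in> Hom C X Y" and X: "X \<in> S" and Y: "Y \<in> S"
    for f X Y
  proof -
    have Xo: "X \<in> Ob C" and Yo: "Y \<in> Ob C" and iX: "is_iso C (l X)"
      using X Y by (auto simp: S_def)
    note Lf = amap_in_Hom[OF f]
    have "(\<epsilon> Y \<cdot> amap L f) \<cdot> l X = \<epsilon> Y \<cdot> (l Y \<cdot> f)"
      using C.Comp_assoc[OF unit_in_Hom[OF Xo] Lf e[OF Y]] unit_natural[OF f] by simp
    also have "\<dots> = f"
      using C.Comp_assoc[OF f unit_in_Hom[OF Yo] e[OF Y]] el[OF Y] C.Id_Comp[OF f] by simp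
    also have "f = (f \<cdot> \<epsilon> X) \<cdot> l X"
      using C.Comp_assoc[OF unit_in_Hom[OF Xo] e[OF X] f] el[OF X] C.Comp_Id[OF f] by simp
    finally show ?thesis
      using C.iso_cancel_right[OF iX unit_in_Hom[OF Xo] C.Comp_in_Hom[OF Lf e[OF Y]]
          C.Comp_in_Hom[OF e[OF X] f]] by blast
  qed
  have "nat_trans D D (L \<circ>\<^sub>F id_functor) id_functor \<epsilon>"
    unfolding nat_trans_def
    using is_functor_comp[OF J K] is_functor_id[OF D.category_axioms] e e_nat LS S
    unfolding KJ by (auto simp: HomDD id_functor_def)
  moreover have "nat_trans C C id_functor (id_functor \<circ>\<^sub>F L) l"
    using unit_nat_trans JK by simp
  moreover have "\<epsilon> (omap L X) \<cdot> amap L (l X) = Id C (omap L X)" if "X \<in> Ob C" for X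
    using amap_unit[OF that] el[OF LS[OF that]] by simp
  ultimately have "adjunction C D L inclusion_functor l \<epsilon>"
    unfolding adjunction_def using K J el by (simp add: id_functor_def)
  then show ?thesis
    unfolding localization_def D_def using S JK
    by (intro exI[of _ S] exI[of _ L] exI[of _ \<epsilon>]) (auto simp: functor_eq_def)
qed

section \<open>Local objects and their orthogonality to equivalences\<close>

lemma local_iso_cong:
  assumes f: "f \<in> Hom C X Y" "is_iso C f"
  shows "local_object C l X \<longleftrightarrow> local_object C l Y"
  using C.iso_square[OF f amap_in_Hom[OF f(1)] amap_iso[OF f], of "l X" "l Y"]
    unit_in_Hom unit_natural[OF f(1)] C.HomD[OF f(1)]
  by (simp add: local_object_def)

text \<open>In the naturality square of \<open>l\<close> at \<open>f\<close> both unit components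
  are invertible.\<close>

lemma equivalence_of_locals:
  assumes f: "f \<in> Hom C X Y" and "local_object C l X" "local_object C l Y"
  shows "is_iso C (amap L f) \<longleftrightarrow> is_iso C f"
  using C.iso_square[of "l X" X _ "l Y" Y _ f "amap L f"] assms unit_in_Hom unit_natural[OF f]
    amap_in_Hom[OF f]
  by (auto simp: local_object_def)

text \<open>Uniqueness half of orthogonality. Cancelling \<open>amap L f\<close> gives
  \<open>amap L v = amap L w\<close>, and the invertible \<open>l Z\<close> recovers
  \<open>v\<close> and \<open>w\<close> from these.\<close>

lemma equivalence_epi:
  assumes f: "f \<in> Hom C X Y" "is_iso C (amap L f)" and Z: "local_object C l Z"
    and v: "v \<in> Hom C Y Z" and w: "w \<in> Hom C Y Z" and eq: "v \<cdot> f = w \<cdot> f"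
  shows "v = w"
proof -
  have Zo: "Z \<in> Ob C" and Y: "Y \<in> Ob C" and Zi: "is_iso C (l Z)"
    using Z C.HomD[OF f(1)] by (auto simp: local_object_def)
  have "amap L v \<cdot> amap L f = amap L w \<cdot> amap L f"
    using amap_Comp[OF f(1) v] amap_Comp[OF f(1) w] eq by simp
  then have "amap L v = amap L w"
    using C.iso_cancel_right[OF f(2) amap_in_Hom[OF f(1)]] amap_in_Hom v w by blast
  then have "l Z \<cdot> v = l Z \<cdot> w"
    using unit_natural[OF v] unit_natural[OF w] by simp
  then show ?thesis
    using C.iso_cancel_left[OF Zi unit_in_Hom[OF Zo] v w] by blast
qed

text \<open>Existence half of orthogonality. With \<open>k\<close> inverse to \<open>l Z\<close> and
  \<open>h\<close> inverse to \<open>amap L f\<close>, the extension is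
  \<open>(k \<cdot> amap L u) \<cdot> (h \<cdot> l Y)\<close>.\<close>

lemma equivalence_extend:
  assumes f: "f \<in> Hom C X Y" "is_iso C (amap L f)" and Z: "local_object C l Z"
    and u: "u \<in> Hom C X Z"
  obtains v where "v \<in> Hom C Y Z" "v \<cdot> f = u"
proof -
  have Zo: "Z \<in> Ob C" and X: "X \<in> Ob C" and Y: "Y \<in> Ob C" and Zi: "is_iso C (l Z)"
    using Z C.HomD[OF f(1)] by (auto simp: local_object_def)
  obtain k where k: "k \<in> Hom C (omap L Z) Z" "k \<cdot> l Z = Id C Z"
    using Zi unit_in_Hom[OF Zo] by (rule C.is_isoE)
  obtain h where h: "h \<in> Hom C (omap L Y) (omap L X)" "h \<cdot> amap L f = Id C (omap L X)"
    using f(2) amap_in_Hom[OF f(1)] by (rule C.is_isoE)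
  note Lu = amap_in_Hom[OF u] and lX = unit_in_Hom[OF X] and lY = unit_in_Hom[OF Y]
    and Lf = amap_in_Hom[OF f(1)]
  note hl = C.Comp_in_Hom[OF lY h(1)]
  note kL = C.Comp_in_Hom[OF Lu k(1)]
  have "((k \<cdot> amap L u) \<cdot> (h \<cdot> l Y)) \<cdot> f = (k \<cdot> amap L u) \<cdot> (h \<cdot> (amap L f \<cdot> l X))"
    using C.Comp_assoc[OF f(1) hl kL] C.Comp_assoc[OF f(1) lY h(1)] unit_natural[OF f(1)] by simp
  also have "\<dots> = (k \<cdot> amap L u) \<cdot> l X"
    using C.Comp_assoc[OF lX Lf h(1)] h(2) C.Id_Comp[OF lX] by simp
  also have "\<dots> = k \<cdot> (l Z \<cdot> u)"
    using C.Comp_assoc[OF lX Lu k(1)] unit_natural[OF u] by simp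
  also have "\<dots> = u"
    using C.Comp_assoc[OF u unit_in_Hom[OF Zo] k(1)] k(2) C.Id_Comp[OF u] by simp
  finally show thesis using that C.Comp_in_Hom[OF hl kL] by blast
qed

text \<open>Recognises equivalences by maps into local objects. The inverse of
  \<open>amap L f\<close> arises by extending \<open>l X\<close> first along \<open>f\<close> to
  \<open>h\<close>, then along \<open>l Y\<close> to \<open>k\<close>.\<close>

lemma equivalenceI:
  assumes f: "f \<in> Hom C X Y"
    and ex: "\<And>Z u. local_object C l Z \<Longrightarrow> u \<in> Hom C X Z \<Longrightarrow> \<exists>v \<in> Hom C Y Z. v \<cdot> f = u"
    and un: "\<And>Z v w. local_object C l Z \<Longrightarrow> v \<in> Hom C Y Z \<Longrightarrow> w \<in> Hom C Y Z \<Longrightarrow>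
      v \<cdot> f = w \<cdot> f \<Longrightarrow> v = w"
  shows "is_iso C (amap L f)"
proof -
  have X: "X \<in> Ob C" and Y: "Y \<in> Ob C" using C.HomD[OF f] by auto
  note lX = unit_in_Hom[OF X] and lY = unit_in_Hom[OF Y] and Lf = amap_in_Hom[OF f]
  note LX = local_omap[OF X] and LY = local_omap[OF Y]
  obtain h where h: "h \<in> Hom C Y (omap L X)" "h \<cdot> f = l X"
    using ex[OF LX lX] by blast
  obtain k where k: "k \<in> Hom C (omap L Y) (omap L X)" "k \<cdot> l Y = h"
    using lY unit_equivalence[OF Y] LX h(1) by (rule equivalence_extend)
  have "(k \<cdot> amap L f) \<cdot> l X = k \<cdot> (l Y \<cdot> f)"
    using C.Comp_assoc[OF lX Lf k(1)] unit_natural[OF f] by simp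
  also have "\<dots> = l X" using C.Comp_assoc[OF f lY k(1)] k(2) h(2) by simp
  also have "\<dots> = Id C (omap L X) \<cdot> l X" using C.Id_Comp[OF lX] by simp
  finally have 1: "k \<cdot> amap L f = Id C (omap L X)"
    using equivalence_epi[OF lX unit_equivalence[OF X] LX C.Comp_in_Hom[OF Lf k(1)]
        C.Id_in_Hom[OF omap_in_Ob[OF X]]] by blast
  \<comment> \<open>The hypothesis \<open>un\<close> will cancel \<open>f\<close> in front of maps
    to the local object \<open>omap L Y\<close>.\<close>
  have "(amap L f \<cdot> h) \<cdot> f = l Y \<cdot> f"
    using C.Comp_assoc[OF f h(1) Lf] h(2) unit_natural[OF f] by simp
  then have "amap L f \<cdot> h = l Y"
    using un[OF LY C.Comp_in_Hom[OF h(1) Lf] lY] by blast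
  then have "(amap L f \<cdot> k) \<cdot> l Y = Id C (omap L Y) \<cdot> l Y"
    using C.Comp_assoc[OF lY k(1) Lf] k(2) C.Id_Comp[OF lY] by simp
  then have "amap L f \<cdot> k = Id C (omap L Y)"
    using equivalence_epi[OF lY unit_equivalence[OF Y] LY C.Comp_in_Hom[OF k(1) Lf]
        C.Id_in_Hom[OF omap_in_Ob[OF Y]]] by blast
  with 1 show ?thesis using C.is_isoI[OF Lf k(1)] by blast
qed

end

section \<open>The Eilenberg--Moore category\<close>

locale eilenberg_moore = is_functor C C T
  for C :: "('o, 'm) cat" (structure) and T :: "('o, 'm, 'o, 'm) fctr" +
  fixes \<eta> \<mu> :: "'o \<Rightarrow> 'm"
  assumes monad: "monad C T \<eta> \<mu>"
begin

abbreviation "CT \<equiv> em_category C T \<eta> \<mu>"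
abbreviation "alg \<equiv> algebra C T \<eta> \<mu>"
abbreviation "alg_mor \<equiv> algebra_morphism C T \<eta> \<mu>"

lemma eta_in_Hom: "X \<in> Ob C \<Longrightarrow> \<eta> X \<in> Hom C X (omap T X)"
  and eta_natural: "f \<in> Hom C X Y \<Longrightarrow> \<eta> Y \<cdot> f = amap T f \<cdot> \<eta> X"
  and mu_in_Hom: "X \<in> Ob C \<Longrightarrow> \<mu> X \<in> Hom C (omap T (omap T X)) (omap T X)"
  and mu_natural: "f \<in> Hom C X Y \<Longrightarrow> \<mu> Y \<cdot> amap T (amap T f) = amap T f \<cdot> \<mu> X"
  and mu_assoc: "X \<in> Ob C \<Longrightarrow> \<mu> X \<cdot> amap T (\<mu> X) = \<mu> X \<cdot> \<mu> (omap T X)"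
  and mu_amap_eta: "X \<in> Ob C \<Longrightarrow> \<mu> X \<cdot> amap T (\<eta> X) = Id C (omap T X)"
  and mu_eta: "X \<in> Ob C \<Longrightarrow> \<mu> X \<cdot> \<eta> (omap T X) = Id C (omap T X)"
  using monad by (simp_all add: monad_def nat_trans_def) (simp_all add: id_functor_def)

lemma algebra_pair:
  "alg (X, a) \<longleftrightarrow> X \<in> Ob C \<and> a \<in> Hom C (omap T X) X \<and>
    a \<cdot> \<eta> X = Id C X \<and> a \<cdot> amap T a = a \<cdot> \<mu> X"
  by (simp add: algebra_def)

lemma algebra_morphism_pair:
  "alg_mor (X, a) (Y, b) g \<longleftrightarrow>
    alg (X, a) \<and> alg (Y, b) \<and> g \<in> Hom C X Y \<and> b \<cdot> amap T g = g \<cdot> a"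
  by (simp add: algebra_morphism_def)

lemma algebra_morphismD:
  assumes "alg_mor A B g"
  shows "alg A" "alg B" "g \<in> Hom C (fst A) (fst B)"
  using assms by (cases A; cases B; simp add: algebra_morphism_pair)+

lemma algebra_morphism_Id: "alg A \<Longrightarrow> alg_mor A A (Id C (fst A))"
  using amap_Id C.Id_in_Hom C.Comp_Id C.Id_Comp
  by (cases A) (auto simp: algebra_morphism_pair algebra_pair)

lemma algebra_morphism_Comp:
  assumes "alg_mor A B g" "alg_mor B E h"
  shows "alg_mor A E (h \<cdot> g)"
proof -
  obtain X a Y b Z c where [simp]: "A = (X, a)" "B = (Y, b)" "E = (Z, c)"
    by (cases A; cases B; cases E)
  have g: "g \<in> Hom C X Y" "b \<cdot> amap T g = g \<cdot> a" and h: "h \<in> Hom C Y Z" "c \<cdot> amap T h = h \<cdot> b"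
    and A: "alg (X, a)" "alg (Z, c)"
    and abc: "a \<in> Hom C (omap T X) X" "b \<in> Hom C (omap T Y) Y" "c \<in> Hom C (omap T Z) Z"
    using assms by (simp_all add: algebra_morphism_pair algebra_pair)
  note Tg = amap_in_Hom[OF g(1)] and Th = amap_in_Hom[OF h(1)]
  have "c \<cdot> amap T (h \<cdot> g) = (h \<cdot> b) \<cdot> amap T g"
    using amap_Comp[OF g(1) h(1)] C.Comp_assoc[OF Tg Th abc(3)] h(2) by simp
  also have "\<dots> = (h \<cdot> g) \<cdot> a"
    using C.Comp_assoc[OF Tg abc(2) h(1)] g(2) C.Comp_assoc[OF abc(1) g(1) h(1)] by simp
  finally show ?thesis
    using A C.Comp_in_Hom[OF g(1) h(1)] by (simp add: algebra_morphism_pair)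
qed

lemma em_sel [simp]:
  "Ob CT = {A. alg A}"
  "Ar CT = {(A, g, B). alg_mor A B g}"
  "Dom CT (A, g, B) = A"
  "Cod CT (A, g, B) = B"
  "Id CT A = (A, Id C (fst A), A)"
  "(B', h, E) \<cdot>\<^bsub>CT\<^esub> (A, g, B) = (A, h \<cdot> g, E)"
  by (simp_all add: em_category_def)

lemma Hom_em: "m \<in> Hom CT A B \<longleftrightarrow> (\<exists>g. m = (A, g, B) \<and> alg_mor A B g)"
  by (cases m) (auto simp: Hom_def)

lemma category_em: "category CT"
proof
  fix f g h W X Y Z
  assume "f \<in> Hom CT W X" "g \<in> Hom CT X Y" "h \<in> Hom CT Y Z"
  then show "(h \<cdot>\<^bsub>CT\<^esub> g) \<cdot>\<^bsub>CT\<^esub> f = h \<cdot>\<^bsub>CT\<^esub> (g \<cdot>\<^bsub>CT\<^esub> f)"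
    using C.Comp_assoc by (auto simp: Hom_em dest!: algebra_morphismD(3))
next
  fix f X Y assume "f \<in> Hom CT X Y"
  then show "f \<cdot>\<^bsub>CT\<^esub> Id CT X = f" "Id CT Y \<cdot>\<^bsub>CT\<^esub> f = f"
    using C.Comp_Id C.Id_Comp by (auto simp: Hom_em dest!: algebra_morphismD(3))
qed (auto simp: Hom_em dest: algebra_morphismD intro: algebra_morphism_Id algebra_morphism_Comp)

sublocale CT: category CT
  by (rule category_em)

lemma em_forget_sel [simp]:
  "omap em_forget A = fst A" "amap em_forget (A, g, B) = g"
  by (cases A; simp add: em_forget_def)+

lemma is_functor_em_forget: "is_functor CT C em_forget"
proof unfold_locales
  show "omap em_forget A \<in> Ob C" if "A \<in> Ob CT" for A
    using that by (cases A) (simp add: algebra_pair)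
qed (auto simp: Hom_em dest: algebra_morphismD)

text \<open>An inverse \<open>h\<close> of \<open>g\<close> in the base category respects the
  structures, because \<open>g \<cdot> (a \<cdot> amap T h)\<close> and
  \<open>g \<cdot> (h \<cdot> b)\<close> both equal \<open>b\<close>. So invertibility of algebra
  morphisms can be tested on underlying arrows.\<close>

lemma is_iso_em:
  assumes m: "alg_mor A B g"
  shows "is_iso CT (A, g, B) \<longleftrightarrow> is_iso C g"
proof
  assume "is_iso CT (A, g, B)"
  then show "is_iso C g"
    using is_functor.amap_iso[OF is_functor_em_forget, of "(A, g, B)" A B] m
    by (auto simp: Hom_em)
next
  assume i: "is_iso C g"
  obtain X a Y b where [simp]: "A = (X, a)" "B = (Y, b)"
    by (cases A; cases B)
  have g: "g \<in> Hom C X Y" "b \<cdot> amap T g = g \<cdot> a" and A: "alg (X, a)" "alg (Y, b)"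
    and a: "a \<in> Hom C (omap T X) X" and b: "b \<in> Hom C (omap T Y) Y"
    and X: "X \<in> Ob C" and Y: "Y \<in> Ob C"
    using m by (simp_all add: algebra_morphism_pair algebra_pair)
  obtain h where h: "h \<in> Hom C Y X" "h \<cdot> g = Id C X" "g \<cdot> h = Id C Y"
    using i g(1) by (rule C.is_isoE)
  note Tg = amap_in_Hom[OF g(1)] and Th = amap_in_Hom[OF h(1)]
  have "g \<cdot> (a \<cdot> amap T h) = (b \<cdot> amap T g) \<cdot> amap T h"
    using C.Comp_assoc[OF Th a g(1)] g(2) by simp
  also have "\<dots> = b"
    using C.Comp_assoc[OF Th Tg b] amap_Comp[OF h(1) g(1)] h(3) amap_Id[OF Y] C.Comp_Id[OF b]
    by simp
  also have "\<dots> = g \<cdot> (h \<cdot> b)"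
    using C.Comp_assoc[OF b h(1) g(1)] h(3) C.Id_Comp[OF b] by simp
  finally have "a \<cdot> amap T h = h \<cdot> b"
    using C.iso_cancel_left[OF i g(1) C.Comp_in_Hom[OF Th a] C.Comp_in_Hom[OF b h(1)]] by blast
  then have h': "alg_mor B A h"
    using A h(1) by (simp add: algebra_morphism_pair)
  show "is_iso CT (A, g, B)"
    by (rule CT.is_isoI[of _ A B "(B, h, A)"]) (use m h' h in \<open>auto simp: Hom_em\<close>)
qed

section \<open>Free algebras and transposition\<close>

lemma free_algebra: "X \<in> Ob C \<Longrightarrow> alg (omap T X, \<mu> X)"
  by (simp add: algebra_pair omap_in_Ob mu_in_Hom mu_eta mu_assoc)

lemma free_algebra_morphism:
  assumes "f \<in> Hom C X Y"
  shows "alg_mor (omap T X, \<mu> X) (omap T Y, \<mu> Y) (amap T f)"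
  using assms C.HomD[OF assms]
  by (simp add: algebra_morphism_pair free_algebra amap_in_Hom mu_natural)

text \<open>The morphism condition turns \<open>c \<cdot> amap T w\<close> into
  \<open>w \<cdot> \<mu> X\<close>, and \<open>\<mu> X \<cdot> amap T (\<eta> X)\<close> is an
  identity. Thus a morphism from a free algebra is determined by its restriction along
  \<open>\<eta> X\<close>.\<close>

lemma free_algebra_transpose:
  assumes w: "alg_mor (omap T X, \<mu> X) (Z, c) w" and X: "X \<in> Ob C"
  shows "w = c \<cdot> amap T (w \<cdot> \<eta> X)"
proof -
  have w': "w \<in> Hom C (omap T X) Z" "c \<cdot> amap T w = w \<cdot> \<mu> X" and c: "c \<in> Hom C (omap T Z) Z"
    using w by (simp_all add: algebra_morphism_pair algebra_pair)
  note e = eta_in_Hom[OF X]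
  have "c \<cdot> amap T (w \<cdot> \<eta> X) = (w \<cdot> \<mu> X) \<cdot> amap T (\<eta> X)"
    using amap_Comp[OF e w'(1)] C.Comp_assoc[OF amap_in_Hom[OF e] amap_in_Hom[OF w'(1)] c] w'(2)
    by simp
  also have "\<dots> = w"
    using C.Comp_assoc[OF amap_in_Hom[OF e] mu_in_Hom[OF X] w'(1)] mu_amap_eta[OF X]
      C.Comp_Id[OF w'(1)] by simp
  finally show ?thesis by simp
qed

text \<open>\<open>c \<cdot> amap T v\<close> is the transpose of \<open>v\<close> under the
  free-forgetful adjunction. It respects the structures by associativity of \<open>c\<close> and
  naturality of \<open>\<mu>\<close>.\<close>

lemma free_algebra_extend:
  assumes c: "alg (Z, c)" and v: "v \<in> Hom C X Z"
  shows "alg_mor (omap T X, \<mu> X) (Z, c) (c \<cdot> amap T v)"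
proof -
  have X: "X \<in> Ob C" and Z: "Z \<in> Ob C" using C.HomD[OF v] by auto
  have c': "c \<in> Hom C (omap T Z) Z" "c \<cdot> amap T c = c \<cdot> \<mu> Z"
    using c by (simp_all add: algebra_pair)
  note Tv = amap_in_Hom[OF v] and Tc = amap_in_Hom[OF c'(1)]
  note TTv = amap_in_Hom[OF Tv]
  have "c \<cdot> amap T (c \<cdot> amap T v) = (c \<cdot> \<mu> Z) \<cdot> amap T (amap T v)"
    using amap_Comp[OF Tv c'(1)] C.Comp_assoc[OF TTv Tc c'(1)] c'(2) by simp
  also have "\<dots> = (c \<cdot> amap T v) \<cdot> \<mu> X"
    using C.Comp_assoc[OF TTv mu_in_Hom[OF Z] c'(1)] mu_natural[OF v]
      C.Comp_assoc[OF mu_in_Hom[OF X] Tv c'(1)] by simp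
  finally show ?thesis
    using free_algebra[OF X] c C.Comp_in_Hom[OF Tv c'(1)] by (simp add: algebra_morphism_pair)
qed

end

section \<open>Localizations of algebras\<close>

locale monad_with_localization = eilenberg_moore C T \<eta> \<mu> + L: idempotent_monad C L l
  for C :: "('o, 'm) cat" (structure) and T :: "('o, 'm, 'o, 'm) fctr" and \<eta> \<mu>
    and L :: "('o, 'm, 'o, 'm) fctr" and l
begin

lemma preserves_equivalences_iff:
  "preserves_equivalences C L C L T \<longleftrightarrow>
    (\<forall>f \<in> Ar C. is_iso C (amap L f) \<longrightarrow> is_iso C (amap L (amap T f)))"
  using amap_in_Ar by (auto simp: preserves_equivalences_def local_equivalence_def)

section \<open>From (a) to (b), with uniqueness of structures and of strict lifts\<close>

context
  assumes pres: "preserves_equivalences C L C L T"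
begin

lemma amap_T_equivalence:
  "f \<in> Hom C X Y \<Longrightarrow> is_iso C (amap L f) \<Longrightarrow> is_iso C (amap L (amap T f))"
  using pres C.HomD by (auto simp: preserves_equivalences_iff)

text \<open>Compatibility with \<open>l X\<close> makes \<open>a'\<close> and \<open>a''\<close>
  agree after \<open>amap T (l X)\<close>. Since \<open>T\<close> preserves equivalences, this arrow
  can be cancelled in front of maps to the local object \<open>omap L X\<close>.\<close>

lemma algebra_structure_unique:
  assumes "alg_mor (X, a) (omap L X, a') (l X)" "alg_mor (X, a) (omap L X, a'') (l X)"
  shows "a' = a''"
proof -
  have X: "X \<in> Ob C" and a: "a' \<in> Hom C (omap T (omap L X)) (omap L X)"
    "a'' \<in> Hom C (omap T (omap L X)) (omap L X)"
    and eq: "a' \<cdot> amap T (l X) = a'' \<cdot> amap T (l X)"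
    using assms by (simp_all add: algebra_morphism_pair algebra_pair)
  show ?thesis
    using L.equivalence_epi[OF amap_in_Hom[OF L.unit_in_Hom[OF X]]
        amap_T_equivalence[OF L.unit_in_Hom[OF X] L.unit_equivalence[OF X]]
        L.local_omap[OF X] a eq] .
qed

lemma algebra_structure_exists:
  assumes alg: "alg (X, a)"
  shows "\<exists>a'. alg_mor (X, a) (omap L X, a') (l X)"
proof -
  have X: "X \<in> Ob C" and a: "a \<in> Hom C (omap T X) X" "a \<cdot> \<eta> X = Id C X"
    "a \<cdot> amap T a = a \<cdot> \<mu> X"
    using alg by (simp_all add: algebra_pair)
  let ?l = "l X" and ?LX = "omap L X"
  note LX = L.omap_in_Ob[OF X] and loc = L.local_omap[OF X]
  note l = L.unit_in_Hom[OF X] and Tl = amap_in_Hom[OF L.unit_in_Hom[OF X]]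
  note TTl = amap_in_Hom[OF Tl] and Ta = amap_in_Hom[OF a(1)]
  note eX = eta_in_Hom[OF X] and eLX = eta_in_Hom[OF LX]
    and mX = mu_in_Hom[OF X] and mLX = mu_in_Hom[OF LX]
  note l_eq = L.unit_equivalence[OF X]
  \<comment> \<open>Preservation of equivalences is iterated: \<open>amap T ?l\<close> carries the
    construction of \<open>a'\<close>, and \<open>amap T (amap T ?l)\<close> is the arrow after
    which associativity is tested.\<close>
  note Tl_eq = amap_T_equivalence[OF l l_eq]
  note TTl_eq = amap_T_equivalence[OF Tl Tl_eq]
  \<comment> \<open>The equation that makes \<open>?l\<close> a morphism is the defining property of
    this extension.\<close>
  obtain a' where a': "a' \<in> Hom C (omap T ?LX) ?LX" "a' \<cdot> amap T ?l = ?l \<cdot> a"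
    using Tl Tl_eq loc C.Comp_in_Hom[OF a(1) l] by (rule L.equivalence_extend)
  note Ta' = amap_in_Hom[OF a'(1)]
  \<comment> \<open>Both sides of the unit law end in a local object, so comparing them after the
    equivalence \<open>?l\<close> suffices.\<close>
  have "(a' \<cdot> \<eta> ?LX) \<cdot> ?l = a' \<cdot> (amap T ?l \<cdot> \<eta> X)"
    using C.Comp_assoc[OF l eLX a'(1)] eta_natural[OF l] by simp
  also have "\<dots> = ?l"
    using C.Comp_assoc[OF eX Tl a'(1)] a'(2) C.Comp_assoc[OF eX a(1) l] a(2) C.Comp_Id[OF l]
    by simp
  also have "\<dots> = Id C ?LX \<cdot> ?l" using C.Id_Comp[OF l] by simp
  finally have unit: "a' \<cdot> \<eta> ?LX = Id C ?LX"
    using L.equivalence_epi[OF l l_eq loc C.Comp_in_Hom[OF eLX a'(1)] C.Id_in_Hom[OF LX]] by blast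
  \<comment> \<open>After \<open>amap T (amap T ?l)\<close> the associativity law for
    \<open>a'\<close> reduces to that for \<open>a\<close>.\<close>
  have "(a' \<cdot> amap T a') \<cdot> amap T (amap T ?l) = a' \<cdot> (amap T ?l \<cdot> amap T a)"
    using C.Comp_assoc[OF TTl Ta' a'(1)] amap_Comp[OF Tl a'(1)] a'(2) amap_Comp[OF a(1) l] by simp
  also have "\<dots> = ?l \<cdot> (a \<cdot> \<mu> X)"
    using C.Comp_assoc[OF Ta Tl a'(1)] a'(2) C.Comp_assoc[OF Ta a(1) l] a(3) by simp
  also have "\<dots> = a' \<cdot> (amap T ?l \<cdot> \<mu> X)"
    using C.Comp_assoc[OF mX a(1) l] a'(2) C.Comp_assoc[OF mX Tl a'(1)] by simp
  also have "\<dots> = (a' \<cdot> \<mu> ?LX) \<cdot> amap T (amap T ?l)"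
    using mu_natural[OF l] C.Comp_assoc[OF TTl mLX a'(1)] by simp
  finally have "a' \<cdot> amap T a' = a' \<cdot> \<mu> ?LX"
    using L.equivalence_epi[OF TTl TTl_eq loc C.Comp_in_Hom[OF Ta' a'(1)]
        C.Comp_in_Hom[OF mLX a'(1)]] by blast
  with unit have "alg_mor (X, a) (?LX, a') ?l"
    using alg a' l LX by (simp add: algebra_morphism_pair algebra_pair)
  then show ?thesis ..
qed

text \<open>Naturality makes \<open>amap L g \<cdot> l X\<close> equal to the morphism
  \<open>l Y \<cdot> g\<close>, so the two sides of the desired equation agree after the equivalence
  \<open>amap T (l X)\<close>.\<close>

lemma amap_L_algebra_morphism:
  assumes g: "alg_mor (X, a) (Y, b) g"
    and a': "alg_mor (X, a) (omap L X, a') (l X)" and b': "alg_mor (Y, b) (omap L Y, b') (l Y)"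
  shows "alg_mor (omap L X, a') (omap L Y, b') (amap L g)"
proof -
  have g': "g \<in> Hom C X Y" and ga: "alg_mor (X, a) (omap L Y, b') (l Y \<cdot> g)"
    using g algebra_morphism_Comp[OF g b'] by (simp_all add: algebra_morphism_pair)
  have X: "X \<in> Ob C" and Y: "Y \<in> Ob C" using C.HomD[OF g'] by auto
  note l = L.unit_in_Hom[OF X] and Lg = L.amap_in_Hom[OF g']
  note Tl = amap_in_Hom[OF l] and TLg = amap_in_Hom[OF Lg]
  have A: "alg (omap L X, a')" "alg (omap L Y, b')" and a: "a \<in> Hom C (omap T X) X"
    and a1: "a' \<in> Hom C (omap T (omap L X)) (omap L X)" "a' \<cdot> amap T (l X) = l X \<cdot> a"
    and b1: "b' \<in> Hom C (omap T (omap L Y)) (omap L Y)"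
    using a' b' by (simp_all add: algebra_morphism_pair algebra_pair)
  have "(b' \<cdot> amap T (amap L g)) \<cdot> amap T (l X) = b' \<cdot> amap T (l Y \<cdot> g)"
    using C.Comp_assoc[OF Tl TLg b1] amap_Comp[OF l Lg] L.unit_natural[OF g'] by simp
  also have "\<dots> = (amap L g \<cdot> l X) \<cdot> a"
    using ga L.unit_natural[OF g'] by (simp add: algebra_morphism_pair)
  also have "\<dots> = (amap L g \<cdot> a') \<cdot> amap T (l X)"
    using C.Comp_assoc[OF a l Lg] a1(2) C.Comp_assoc[OF Tl a1(1) Lg] by simp
  finally have "b' \<cdot> amap T (amap L g) = amap L g \<cdot> a'"
    using L.equivalence_epi[OF Tl amap_T_equivalence[OF l L.unit_equivalence[OF X]]
        L.local_omap[OF Y] C.Comp_in_Hom[OF TLg b1] C.Comp_in_Hom[OF a1(1) Lg]] by blast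
  then show ?thesis using A Lg by (simp add: algebra_morphism_pair)
qed

lemma ex_lifts_to_algebras: "\<exists>t. lifts_to_algebras C T \<eta> \<mu> L l t"
proof -
  \<comment> \<open>Any structure for which \<open>l X\<close> is a morphism may be chosen; outside
    algebras the value of \<open>t\<close> is arbitrary.\<close>
  define t where "t = (\<lambda>(X, a). SOME a'. alg_mor (X, a) (omap L X, a') (l X))"
  have t: "alg_mor (X, a) (omap L X, t (X, a)) (l X)" if "alg (X, a)" for X a
    unfolding t_def using someI_ex[OF algebra_structure_exists[OF that]] by simp
  moreover have "alg_mor (omap L X, t (X, a)) (omap L Y, t (Y, b)) (amap L g)"
    if g: "alg_mor (X, a) (Y, b) g" for X a Y b g
    using amap_L_algebra_morphism[OF g t t] algebra_morphismD[OF g] by blast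
  ultimately show ?thesis
    unfolding lifts_to_algebras_def using algebra_morphismD(2) by blast
qed

text \<open>A strict lift sends \<open>A\<close> to an algebra on \<open>omap L (fst A)\<close>
  whose structure makes the unit a morphism, and there is only one such structure. Arrows of
  \<open>CT\<close> are then fixed by their endpoints and underlying arrow.\<close>

lemma strict_lift_unique:
  assumes LT: "idempotent_monad CT LT lT" "lifts_strictly CT em_forget L l LT lT"
    and LT': "idempotent_monad CT LT' lT'" "lifts_strictly CT em_forget L l LT' lT'"
  shows "functor_eq CT LT LT' \<and> (\<forall>A \<in> Ob CT. lT A = lT' A)"
proof -
  have omap_lift: "fst (omap N A) = omap L (fst A)"
    and unit_lift: "alg_mor A (omap N A) (l (fst A)) \<and> n A = (A, l (fst A), omap N A)"
    if N: "idempotent_monad CT N n" "lifts_strictly CT em_forget L l N n" and A: "alg A" for N n A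
  proof -
    interpret N: idempotent_monad CT N n by fact
    show "fst (omap N A) = omap L (fst A)"
      using N(2) A by (cases A) (simp add: lifts_strictly_def functor_eq_def)
    show "alg_mor A (omap N A) (l (fst A)) \<and> n A = (A, l (fst A), omap N A)"
      using N(2) N.unit_in_Hom[of A] A by (cases A) (auto simp: lifts_strictly_def Hom_em)
  qed
  have amap_lift: "amap N (A, g, B) = (omap N A, amap L g, omap N B)"
    if N: "idempotent_monad CT N n" "lifts_strictly CT em_forget L l N n" and g: "alg_mor A B g"
    for N n A B g
  proof -
    interpret N: idempotent_monad CT N n by fact
    show ?thesis
      using N(2) N.amap_in_Hom[of "(A, g, B)" A B] g
      by (cases A; cases B) (auto simp: lifts_strictly_def functor_eq_def Hom_em)
  qed
  have o: "omap LT A = omap LT' A" if A: "alg A" for A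
  proof -
    obtain X a where Xa: "A = (X, a)" by (cases A)
    obtain b b' where b: "omap LT A = (omap L X, b)" "omap LT' A = (omap L X, b')"
      using omap_lift[OF LT A] omap_lift[OF LT' A] Xa
      by (metis fst_conv prod.collapse)
    show ?thesis
      using algebra_structure_unique[of X a b b'] unit_lift[OF LT A] unit_lift[OF LT' A] b Xa
      by simp
  qed
  moreover have "amap LT m = amap LT' m" if "m \<in> Ar CT" for m
    using that amap_lift[OF LT] amap_lift[OF LT'] o algebra_morphismD(1,2) by fastforce
  moreover have "lT A = lT' A" if "alg A" for A
    using unit_lift[OF LT that] unit_lift[OF LT' that] o[OF that] by simp
  ultimately show ?thesis by (simp add: functor_eq_def)
qed

end

section \<open>From (b) to (c) and from (c) to (d)\<close>

lemma ex_strict_lift: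
  assumes "lifts_to_algebras C T \<eta> \<mu> L l t"
  shows "\<exists>LT lT. idempotent_monad CT LT lT \<and> lifts_strictly CT em_forget L l LT lT"
proof -
  \<comment> \<open>Arrows of \<open>CT\<close> record their endpoints, so \<open>P\<close> has to
    supply the algebras between which \<open>amap L g\<close> and the lifted units run.\<close>
  define P where "P A = (omap L (fst A), t A)" for A
  define LT where "LT = \<lparr>omap = P, amap = (\<lambda>(A, g, B). (P A, amap L g, P B))\<rparr>"
  define lT where "lT A = (A, l (fst A), P A)" for A
  have unit: "alg_mor A (P A) (l (fst A))" if "alg A" for A
    using assms that by (cases A) (simp add: lifts_to_algebras_def P_def)
  have amap: "alg_mor (P A) (P B) (amap L g)" if "alg_mor A B g" for A B g
    using assms that by (cases A; cases B) (simp add: lifts_to_algebras_def P_def)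
  have algP: "alg (P A)" if "alg A" for A
    using algebra_morphismD(2)[OF unit[OF that]] .
  have LT [simp]: "omap LT A = P A" "amap LT (A, g, B) = (P A, amap L g, P B)" for A g B
    by (simp_all add: LT_def)
  have fst_P [simp]: "fst (P A) = omap L (fst A)" for A
    by (simp add: P_def)
  have Ob: "fst A \<in> Ob C" if "alg A" for A
    using that by (cases A) (simp add: algebra_pair)
  \<comment> \<open>All equations reduce to those of \<open>L\<close> on underlying arrows, since
    the endpoints of both sides match.\<close>
  have "idempotent_monad CT LT lT"
  proof unfold_locales
    fix A assume "A \<in> Ob CT"
    then have A: "alg A" by simp
    show "omap LT A \<in> Ob CT" using algP[OF A] by simp
    show "amap LT (Id CT A) = Id CT (omap LT A)" using L.amap_Id[OF Ob[OF A]] by simp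
    show "lT A \<in> Hom CT A (omap LT A)" using unit[OF A] by (simp add: Hom_em lT_def)
    show "amap LT (lT A) = lT (omap LT A)" using L.amap_unit[OF Ob[OF A]] by (simp add: lT_def)
    \<comment> \<open>Invertibility lifts from the base category because the inverse of an algebra
      morphism is again one.\<close>
    show "is_iso CT (lT (omap LT A))"
      using is_iso_em[OF unit[OF algP[OF A]]] L.iso_unit[OF Ob[OF A]] by (simp add: lT_def)
  next
    fix f A B assume "f \<in> Hom CT A B"
    then obtain g where g: "f = (A, g, B)" "alg_mor A B g" by (auto simp: Hom_em)
    show "amap LT f \<in> Hom CT (omap LT A) (omap LT B)" using amap g by (simp add: Hom_em)
    show "lT B \<cdot>\<^bsub>CT\<^esub> f = amap LT f \<cdot>\<^bsub>CT\<^esub> lT A"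
      using g L.unit_natural[OF algebra_morphismD(3)] by (simp add: lT_def)
    fix f' E assume "f' \<in> Hom CT B E"
    then obtain g' where g': "f' = (B, g', E)" "alg_mor B E g'" by (auto simp: Hom_em)
    show "amap LT (f' \<cdot>\<^bsub>CT\<^esub> f) = amap LT f' \<cdot>\<^bsub>CT\<^esub> amap LT f"
      using g g' L.amap_Comp[OF algebra_morphismD(3) algebra_morphismD(3)] by simp
  qed
  moreover have "lifts_strictly CT em_forget L l LT lT"
    by (auto simp: lifts_strictly_def functor_eq_def lT_def)
  ultimately show ?thesis by blast
qed

text \<open>The two composites agree on objects and arrows of \<open>CT\<close>, so identity arrows
  serve as the components.\<close>

lemma nat_iso_if_lifts_strictly:
  assumes "idempotent_monad CT LT lT" "lifts_strictly CT em_forget L l LT lT"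
  shows "\<exists>\<phi>. nat_iso CT C (L \<circ>\<^sub>F em_forget) (em_forget \<circ>\<^sub>F LT) \<phi>"
proof -
  interpret LT: idempotent_monad CT LT lT by fact
  let ?F = "L \<circ>\<^sub>F em_forget" and ?G = "em_forget \<circ>\<^sub>F LT"
  have F: "is_functor CT C ?F" and G: "is_functor CT C ?G"
    using is_functor_comp is_functor_em_forget L.is_functor_axioms LT.is_functor_axioms by blast+
  interpret F: is_functor CT C ?F by fact
  have eq: "functor_eq CT ?F ?G" using assms(2) by (simp add: lifts_strictly_def)
  have o: "omap ?G A = omap ?F A" if "A \<in> Ob CT" for A
    using eq that by (cases A) (simp add: functor_eq_def)
  have "nat_iso CT C ?F ?G (\<lambda>A. Id C (omap ?F A))"
    unfolding nat_iso_def nat_trans_def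
  proof (intro conjI ballI allI F G)
    fix A assume A: "A \<in> Ob CT"
    show "Id C (omap ?F A) \<in> Hom C (omap ?F A) (omap ?G A)"
      using C.Id_in_Hom[OF F.omap_in_Ob[OF A]] o[OF A] by simp
    show "is_iso C (Id C (omap ?F A))" using C.iso_Id[OF F.omap_in_Ob[OF A]] .
  next
    fix A B f assume f: "f \<in> Hom CT A B"
    then have "amap ?G f = amap ?F f"
      using eq CT.HomD[OF f] unfolding functor_eq_def by metis
    then show "Id C (omap ?F B) \<cdot> amap ?F f = amap ?G f \<cdot> Id C (omap ?F A)"
      using C.Comp_Id C.Id_Comp F.amap_in_Hom[OF f] by simp
  qed
  then show ?thesis by blast
qed

end

section \<open>From (d) to (a), with preservation and reflection by the forgetful functor\<close>

locale lifted_localization = monad_with_localization C T \<eta> \<mu> L l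
    + LT: idempotent_monad "em_category C T \<eta> \<mu>" LT lT
  for C :: "('o, 'm) cat" (structure) and T :: "('o, 'm, 'o, 'm) fctr" and \<eta> \<mu>
    and L :: "('o, 'm, 'o, 'm) fctr" and l LT lT +
  fixes \<phi>
  assumes nat_iso: "nat_iso CT C (L \<circ>\<^sub>F em_forget) (em_forget \<circ>\<^sub>F LT) \<phi>"
begin

lemma Ob_fst: "alg A \<Longrightarrow> fst A \<in> Ob C"
  by (cases A) (simp add: algebra_pair)

lemma phi_in_Hom: "alg A \<Longrightarrow> \<phi> A \<in> Hom C (omap L (fst A)) (fst (omap LT A))"
  and phi_iso: "alg A \<Longrightarrow> is_iso C (\<phi> A)"
  using nat_iso by (cases A; simp add: nat_iso_def nat_trans_def)+

lemma amap_LT: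
  assumes "alg_mor A B g"
  obtains h where "amap LT (A, g, B) = (omap LT A, h, omap LT B)"
    "alg_mor (omap LT A) (omap LT B) h" "\<phi> B \<cdot> amap L g = h \<cdot> \<phi> A"
proof -
  have g: "(A, g, B) \<in> Hom CT A B" using assms by (simp add: Hom_em)
  then obtain h where h: "amap LT (A, g, B) = (omap LT A, h, omap LT B)"
    "alg_mor (omap LT A) (omap LT B) h"
    using LT.amap_in_Hom[OF g] by (auto simp: Hom_em)
  have "\<phi> B \<cdot> amap (L \<circ>\<^sub>F em_forget) (A, g, B) = amap (em_forget \<circ>\<^sub>F LT) (A, g, B) \<cdot> \<phi> A"
    using nat_iso g unfolding nat_iso_def nat_trans_def by blast
  then show thesis using h that by simp
qed

text \<open>The naturality square of \<open>\<phi>\<close> at \<open>g\<close> has invertible sides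
  and relates \<open>amap L g\<close> to the arrow underlying \<open>amap LT (A, g, B)\<close>;
  \<open>is_iso_em\<close> then brings in the algebra structures.\<close>

lemma equivalence_iff:
  assumes g: "alg_mor A B g"
  shows "is_iso CT (amap LT (A, g, B)) \<longleftrightarrow> is_iso C (amap L g)"
proof -
  obtain h where h: "amap LT (A, g, B) = (omap LT A, h, omap LT B)"
    "alg_mor (omap LT A) (omap LT B) h" "\<phi> B \<cdot> amap L g = h \<cdot> \<phi> A"
    using g by (rule amap_LT)
  have A: "alg A" and B: "alg B" using algebra_morphismD[OF g] by auto
  have "is_iso C (amap L g) \<longleftrightarrow> is_iso C h"
    using C.iso_square[OF phi_in_Hom[OF A] phi_iso[OF A] phi_in_Hom[OF B] phi_iso[OF B]
        L.amap_in_Hom[OF algebra_morphismD(3)[OF g]] algebra_morphismD(3)[OF h(2)] h(3)] .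
  then show ?thesis using is_iso_em[OF h(2)] h(1) by simp
qed

lemma unit_em:
  assumes "alg A"
  obtains h where "lT A = (A, h, omap LT A)" "alg_mor A (omap LT A) h"
  using LT.unit_in_Hom[of A] assms that by (auto simp: Hom_em)

text \<open>Locality is carried along \<open>\<phi> A\<close> from
  \<open>omap L (fst A)\<close>.\<close>

lemma local_fst_LT:
  assumes "alg A"
  shows "local_object C l (fst (omap LT A))"
  using L.local_iso_cong[OF phi_in_Hom[OF assms] phi_iso[OF assms]]
    L.local_omap[OF Ob_fst[OF assms]] by simp

text \<open>The arrow \<open>h\<close> underlying \<open>lT A\<close> may differ from the unit
  \<open>l\<close>, but it is an \<open>L\<close>-equivalence because \<open>LT\<close> inverts
  \<open>lT A\<close>, and its target is local. If its source is local too, then \<open>h\<close> is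
  invertible; conversely, locality passes back along an invertible \<open>h\<close>.\<close>

lemma local_iff:
  assumes A: "alg A"
  shows "local_object CT lT A \<longleftrightarrow> local_object C l (fst A)"
proof -
  obtain h where h: "lT A = (A, h, omap LT A)" "alg_mor A (omap LT A) h"
    using A by (rule unit_em)
  note h' = algebra_morphismD(3)[OF h(2)]
  have "is_iso C (amap L h)"
    using equivalence_iff[OF h(2)] LT.unit_equivalence[of A] A h(1) by simp
  then have "is_iso C h \<longleftrightarrow> local_object C l (fst A)"
    using L.equivalence_of_locals[OF h'] L.local_iso_cong[OF h'] local_fst_LT[OF A] by blast
  then show ?thesis using is_iso_em[OF h(2)] h(1) A by (simp add: local_object_def)
qed

lemma local_em_D:
  assumes "local_object CT lT A"
  shows "alg A" "local_object C l (fst A)"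
proof -
  show "alg A" using assms unfolding local_object_def by simp
  then show "local_object C l (fst A)" using local_iff assms by blast
qed

lemma em_forget_preserves_reflects:
  "preserves_local_objects CT lT C l em_forget" "reflects_local_objects CT lT C l em_forget"
  "preserves_equivalences CT LT C L em_forget" "reflects_equivalences CT LT C L em_forget"
  using local_iff equivalence_iff C.HomD[OF algebra_morphismD(3)]
  by (auto simp: preserves_local_objects_def reflects_local_objects_def
      preserves_equivalences_def reflects_equivalences_def local_equivalence_def)

text \<open>The forgetful functor preserves local objects, so its left adjoint, the free algebra functor,
  preserves equivalences; the forgetful functor preserves these in turn.\<close>

lemma preserves_equivalences_T: "preserves_equivalences C L C L T"
  unfolding preserves_equivalences_iff
proof (intro ballI impI)
  fix f assume fA: "f \<in> Ar C" and fe: "is_iso C (amap L f)"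
  obtain X Y where f: "f \<in> Hom C X Y" using C.Ar_Hom[OF fA] by blast
  have X: "X \<in> Ob C" and Y: "Y \<in> Ob C" using C.HomD[OF f] by auto
  note eX = eta_in_Hom[OF X] and eY = eta_in_Hom[OF Y] and Tf = amap_in_Hom[OF f]
  let ?FX = "(omap T X, \<mu> X)" and ?FY = "(omap T Y, \<mu> Y)"
  note Ff = free_algebra_morphism[OF f]
  \<comment> \<open>Restriction along \<open>\<eta>\<close> turns composition with
    \<open>amap T f\<close> into composition with \<open>f\<close>.\<close>
  have transpose: "(w \<cdot> \<eta> Y) \<cdot> f = (w \<cdot> amap T f) \<cdot> \<eta> X" if w: "w \<in> Hom C (omap T Y) Z" for w Z
    using C.Comp_assoc[OF f eY w] eta_natural[OF f] C.Comp_assoc[OF eX Tf w] by simp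
  \<comment> \<open>The free morphism on \<open>f\<close> is tested against local algebras, by
    orthogonality in \<open>CT\<close>.\<close>
  have "is_iso CT (amap LT (?FX, amap T f, ?FY))"
  proof (rule LT.equivalenceI)
    show "(?FX, amap T f, ?FY) \<in> Hom CT ?FX ?FY" using Ff by (simp add: Hom_em)
  next
    fix A m assume "local_object CT lT A" and m: "m \<in> Hom CT ?FX A"
    then have A: "alg A" "local_object C l (fst A)"
      using local_em_D by blast+
    obtain Z c where Z: "A = (Z, c)" by (cases A)
    have c: "alg (Z, c)" "c \<in> Hom C (omap T Z) Z" and loc: "local_object C l Z"
      using A Z by (simp_all add: algebra_pair)
    obtain u where u: "m = (?FX, u, A)" "alg_mor ?FX A u"
      using m by (auto simp: Hom_em)
    have uZ: "u \<in> Hom C (omap T X) Z" using algebra_morphismD(3)[OF u(2)] Z by simp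
    \<comment> \<open>The transpose \<open>u \<cdot> \<eta> X\<close> ends in the local object
      \<open>Z\<close>, so it extends along \<open>f\<close>; transposing the extension
      \<open>v\<close> back gives the desired morphism.\<close>
    obtain v where v: "v \<in> Hom C Y Z" "v \<cdot> f = u \<cdot> \<eta> X"
      using f fe loc C.Comp_in_Hom[OF eX uZ] by (rule L.equivalence_extend)
    have "(c \<cdot> amap T v) \<cdot> amap T f = c \<cdot> amap T (u \<cdot> \<eta> X)"
      using C.Comp_assoc[OF Tf amap_in_Hom[OF v(1)] c(2)] amap_Comp[OF f v(1)] v(2) by simp
    also have "\<dots> = u" using free_algebra_transpose[of X Z c u] u(2) Z X by simp
    finally show "\<exists>n \<in> Hom CT ?FY A. n \<cdot>\<^bsub>CT\<^esub> (?FX, amap T f, ?FY) = m"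
      using free_algebra_extend[OF c(1) v(1)] u(1) Z
      by (intro bexI[of _ "(?FY, c \<cdot> amap T v, A)"]) (auto simp: Hom_em)
  next
    fix A m n
    assume "local_object CT lT A" and m: "m \<in> Hom CT ?FY A" and n: "n \<in> Hom CT ?FY A"
      and eq: "m \<cdot>\<^bsub>CT\<^esub> (?FX, amap T f, ?FY) = n \<cdot>\<^bsub>CT\<^esub> (?FX, amap T f, ?FY)"
    then have A: "alg A" "local_object C l (fst A)"
      using local_em_D by blast+
    obtain Z c where Z: "A = (Z, c)" by (cases A)
    obtain v w where v: "m = (?FY, v, A)" "alg_mor ?FY A v" and w: "n = (?FY, w, A)" "alg_mor ?FY A w"
      using m n by (auto simp: Hom_em)
    have vZ: "v \<in> Hom C (omap T Y) Z" and wZ: "w \<in> Hom C (omap T Y) Z"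
      using algebra_morphismD(3)[OF v(2)] algebra_morphismD(3)[OF w(2)] Z by simp_all
    have "v \<cdot> amap T f = w \<cdot> amap T f" using eq v(1) w(1) by simp
    \<comment> \<open>The transposes of \<open>v\<close> and \<open>w\<close> agree after the
      equivalence \<open>f\<close>, hence agree, and they determine \<open>v\<close> and
      \<open>w\<close>.\<close>
    then have "(v \<cdot> \<eta> Y) \<cdot> f = (w \<cdot> \<eta> Y) \<cdot> f" using transpose vZ wZ by simp
    then have "v \<cdot> \<eta> Y = w \<cdot> \<eta> Y"
      using L.equivalence_epi[OF f fe _ C.Comp_in_Hom[OF eY vZ] C.Comp_in_Hom[OF eY wZ]] A(2) Z
      by simp
    then have "v = w"
      using free_algebra_transpose[of Y Z c v] free_algebra_transpose[of Y Z c w] v(2) w(2) Z Y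
      by simp
    then show "m = n" using v(1) w(1) by simp
  qed
  then show "is_iso C (amap L (amap T f))" using equivalence_iff[OF Ff] by simp
qed

end

section \<open>The cycle of implications and the uniqueness statements\<close>

theorem theorem4p2:
  fixes C :: "('o, 'm) cat"
    and T L :: "('o, 'm, 'o, 'm) fctr"
    and \<eta> \<mu> l :: "'o \<Rightarrow> 'm"
    and CT :: "('o \<times> 'm, ('o \<times> 'm) \<times> 'm \<times> ('o \<times> 'm)) cat"
    and U :: "('o \<times> 'm, ('o \<times> 'm) \<times> 'm \<times> ('o \<times> 'm), 'o, 'm) fctr"
  assumes "category C"
    and "monad C T \<eta> \<mu>"
    and "localization C L l"
    and "CT = em_category C T \<eta> \<mu>"
    and "U = em_forget"
  shows
    "(preserves_equivalences C L C L T \<longleftrightarrow> (\<exists>t. lifts_to_algebras C T \<eta> \<mu> L l t)) \<and>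
     (preserves_equivalences C L C L T \<longleftrightarrow>
       (\<exists>LT lT. localization CT LT lT \<and> lifts_strictly CT U L l LT lT)) \<and>
     (preserves_equivalences C L C L T \<longleftrightarrow>
       (\<exists>LT lT. localization CT LT lT \<and> (\<exists>\<phi>. nat_iso CT C (L \<circ>\<^sub>F U) (U \<circ>\<^sub>F LT) \<phi>))) \<and>
     (preserves_equivalences C L C L T \<longrightarrow>
       (\<forall>X a. algebra C T \<eta> \<mu> (X, a) \<longrightarrow>
         (\<exists>!a'. algebra C T \<eta> \<mu> (omap L X, a') \<and>
           algebra_morphism C T \<eta> \<mu> (X, a) (omap L X, a') (l X))) \<and>
       (\<forall>LT lT LT' lT'.
         localization CT LT lT \<and> lifts_strictly CT U L l LT lT \<and>
         localization CT LT' lT' \<and> lifts_strictly CT U L l LT' lT' \<longrightarrow>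
         functor_eq CT LT LT' \<and> (\<forall>A \<in> Ob CT. lT A = lT' A)) \<and>
       (\<forall>LT lT.
         localization CT LT lT \<and>
         (lifts_strictly CT U L l LT lT \<or> (\<exists>\<phi>. nat_iso CT C (L \<circ>\<^sub>F U) (U \<circ>\<^sub>F LT) \<phi>)) \<longrightarrow>
         preserves_local_objects CT lT C l U \<and> reflects_local_objects CT lT C l U \<and>
         preserves_equivalences CT LT C L U \<and> reflects_equivalences CT LT C L U))"
proof -
  note CT = \<open>CT = em_category C T \<eta> \<mu>\<close> and U = \<open>U = em_forget\<close>
  interpret T: is_functor C C T using assms(2) by (simp add: monad_def)
  interpret L: idempotent_monad C L l using assms(3) by (rule idempotent_monad_if_localization)
  interpret M: monad_with_localization C T \<eta> \<mu> L l
    by unfold_locales (fact assms(2))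
  let ?a = "preserves_equivalences C L C L T"
  let ?b = "\<exists>t. lifts_to_algebras C T \<eta> \<mu> L l t"
  let ?c = "\<exists>LT lT. localization CT LT lT \<and> lifts_strictly CT U L l LT lT"
  let ?d = "\<exists>LT lT. localization CT LT lT \<and> (\<exists>\<phi>. nat_iso CT C (L \<circ>\<^sub>F U) (U \<circ>\<^sub>F LT) \<phi>)"
  have strict: "\<exists>\<phi>. nat_iso CT C (L \<circ>\<^sub>F U) (U \<circ>\<^sub>F LT) \<phi>"
    if "localization CT LT lT" "lifts_strictly CT U L l LT lT" for LT lT
    using M.nat_iso_if_lifts_strictly idempotent_monad_if_localization that unfolding CT U by blast
  have lifted: "lifted_localization C T \<eta> \<mu> L l LT lT \<phi>"
    if "localization CT LT lT" "nat_iso CT C (L \<circ>\<^sub>F U) (U \<circ>\<^sub>F LT) \<phi>" for LT lT \<phi>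
    using that M.monad_with_localization_axioms idempotent_monad_if_localization
    unfolding CT U by (intro lifted_localization.intro lifted_localization_axioms.intro)
  have ab: "?a \<Longrightarrow> ?b" by (rule M.ex_lifts_to_algebras)
  \<comment> \<open>The lift is built as an idempotent monad; its local algebras supply the
    reflective subcategory that \<open>localization\<close> asks for.\<close>
  have bc: "?b \<Longrightarrow> ?c"
    using M.ex_strict_lift idempotent_monad.is_localization unfolding CT U by blast
  have cd: "?c \<Longrightarrow> ?d" using strict by blast
  have da: "?d \<Longrightarrow> ?a" using lifted lifted_localization.preserves_equivalences_T by blast
  have structure_unique: "\<exists>!a'. algebra C T \<eta> \<mu> (omap L X, a') \<and>
      algebra_morphism C T \<eta> \<mu> (X, a) (omap L X, a') (l X)"
    if ?a "algebra C T \<eta> \<mu> (X, a)" for X a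
    using M.algebra_structure_exists[OF that] M.algebra_structure_unique[OF that(1)]
      M.algebra_morphismD(2) by blast
  have localization_unique: "functor_eq CT LT LT' \<and> (\<forall>A \<in> Ob CT. lT A = lT' A)"
    if ?a "localization CT LT lT" "lifts_strictly CT U L l LT lT"
      "localization CT LT' lT'" "lifts_strictly CT U L l LT' lT'" for LT lT LT' lT'
    using M.strict_lift_unique idempotent_monad_if_localization that unfolding CT U by blast
  have forget: "preserves_local_objects CT lT C l U \<and> reflects_local_objects CT lT C l U \<and>
      preserves_equivalences CT LT C L U \<and> reflects_equivalences CT LT C L U"
    if loc: "localization CT LT lT"
      and lift: "lifts_strictly CT U L l LT lT \<or> (\<exists>\<phi>. nat_iso CT C (L \<circ>\<^sub>F U) (U \<circ>\<^sub>F LT) \<phi>)" for LT lT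
  proof -
    \<comment> \<open>A strict lift also yields such a \<open>\<phi>\<close>, so both alternatives
      reduce to the situation of (d).\<close>
    obtain \<phi> where "nat_iso CT C (L \<circ>\<^sub>F U) (U \<circ>\<^sub>F LT) \<phi>" using lift strict[OF loc] by blast
    then interpret lifted_localization C T \<eta> \<mu> L l LT lT \<phi> using loc by (intro lifted)
    show ?thesis using em_forget_preserves_reflects unfolding CT U by blast
  qed
  show ?thesis
    using ab bc cd da structure_unique localization_unique forget by (intro conjI impI allI) blast+
qed

end
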